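(* Let $n=2k+1\ge3$ be odd and let $G=D_{2n}\subset\mathrm{SL}(3,\mathbb C)$ be the dihedral group of order $2n$ generated by $\rho=\mathrm{diag}(\zeta,\zeta^{-1},1)$ and $\varepsilon=\begin{pmatrix}0&1&0\\1&0&0\\0&0&-1\end{pmatrix}$, where $\zeta$ is a primitive $n$-th root of unity. For $i\in\{0,\dots,k\}$ let $X_i\to\mathbb C^3/G$ be the crepant resolution corresponding to the GIT chamber $\sigma_i$. Let $W_j,W_j'$ $(1\le j\le k)$, $W_0$, $W_u$ be the irreducible components, described in the context, of the subset of $\mathrm{Spec}\,\mathcal R(X)$ mapped to the central fibre. For $i\in\{1,\dots,k\}$ the stable components of this set for $X_i$ are $W_1,\dots,W_i,W_i',\dots,W_k'$. For $X_0$ the stable components are $W_0,W_1',\dots,W_k'$.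
   Context: A crepant resolution of $\mathbb C^3/G$ is a projective birational morphism $\varphi:X\to\mathbb C^3/G$ with $X$ smooth, an isomorphism outside the singular locus of $\mathbb C^3/G$, with $\varphi^*K_{\mathbb C^3/G}=K_X$. All crepant resolutions of $\mathbb C^3/G$ share the Cox ring $\mathcal R(X)=\bigoplus_{[D]\in\mathrm{Cl}(X)}H^0(X,\mathcal O_X(D))$, which here is $$\mathcal R(X)\simeq\mathbb C[Z_1,Z_2,Z_3,Z_4,T_\varepsilon,T_1,\dots,T_k]\big/\big(Z_1^2-Z_2^2T_\varepsilon-4Z_3^n\textstyle\prod_{i=1}^kT_i^{n-2i}\big),$$ where the variables correspond, via the embedding of $\mathcal R(X)$ into $\mathbb C[x,y,z]^{[G,G]}[t_\varepsilon^{\pm1},t_1^{\pm1},\dots,t_k^{\pm1}]$, to $Z_1\mapsto(x^n+y^n)\prod_it_i^{in/\gcd(n,i)}$, $Z_2\mapsto(x^n-y^n)t_\varepsilon\prod_it_i^{in/\gcd(n,i)}$, $Z_3\mapsto xy\prod_it_i^{n/\gcd(n,i)}$, $Z_4\mapsto zt_\varepsilon$, $T_\varepsilon\mapsto t_\varepsilon^{-2}$, $T_i\mapsto t_i^{-n/\gcd(n,i)}$. The grading group tensored with $\mathbb R$ is $\mathbb R^{k+1}$; after rescaling the $t_i$-coordinate by $\gcd(n,i)/n$, the degrees are: $Z_1:(1,2,\dots,k,0)$, $Z_2:(1,2,\dots,k,1)$, $Z_3:(1,\dots,1,0)$, $Z_4:e_{k+1}$, $T_\varepsilon:-2e_{k+1}$,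 $T_i:-e_i$. The torus $\mathbb T_X=\mathrm{Hom}(\mathrm{Cl}(X),\mathbb C^* )$ acts on $\mathrm{Spec}\,\mathcal R(X)\subset\mathbb C^{k+5}$ accordingly. Put $q=e_{k+1}$, $v_i=(1,2,\dots,i-1,i,\dots,i,0)$, $w_i=v_i+q$ for $1\le i\le k$. The GIT chambers of the movable cone are $\sigma_0=\mathrm{cone}(q,w_1,\dots,w_k)$ and $\sigma_i=\mathrm{cone}(v_1,\dots,v_i,w_i,\dots,w_k)$, $1\le i\le k$. $X_i$ is the GIT quotient of $\mathrm{Spec}\,\mathcal R(X)$ by $\mathbb T_X$ with linearisation given by a character in the interior of $\sigma_i$. The degree-zero part of $\mathcal R(X)$ is $\mathbb C[x,y,z]^G$. The subset of $\mathrm{Spec}\,\mathcal R(X)$ mapped to the central fibre (the fibre over $[0]\in\mathbb C^3/G$) is the set of points lying over $[0]$ under $\mathrm{Spec}\,\mathcal R(X)\to\mathrm{Spec}\,\mathbb C[x,y,z]^G$. Its irreducible components are $W_j=\{Z_4=T_j=Z_1^2-Z_2^2T_\varepsilon=0\}$, $W_j'=\{Z_1=T_\varepsilon=T_j=0\}$ for $1\le j\le k$, $W_0=\{Z_1=Z_3=T_\varepsilon=0\}$, $W_u=\{Z_1=Z_2=Z_3=Z_4=0\}$. A component is stable for $X_i$ if its general point is stable with respect to a linearisation from the interior of $\sigma_i$ (equivalently, this linearisation lies in the interior of the cone spanned by the degrees of all the variables not vanishing at a general point of the component). *)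

theory Defs
  imports "HOL-Analysis.Analysis" "HOL-Library.Poly_Mapping"
begin

text \<open>A polynomial is a finitely supported map from monomials (finitely supported exponent
  maps) to coefficients.\<close>

type_synonym 'v cpoly = "('v \<Rightarrow>\<^sub>0 nat) \<Rightarrow>\<^sub>0 complex"

definition peval :: "'v cpoly \<Rightarrow> ('v \<Rightarrow> complex) \<Rightarrow> complex" where
  "peval F p =
     (\<Sum>m\<in>Poly_Mapping.keys F. Poly_Mapping.lookup F m *
     (\<Prod>v\<in>Poly_Mapping.keys m. p v ^ Poly_Mapping.lookup m v))"

definition primitive_root_of_unity :: "nat \<Rightarrow> complex \<Rightarrow> bool" where
  "primitive_root_of_unity n \<zeta> \<longleftrightarrow> n > 0 \<and> \<zeta> ^ n = 1 \<and> (\<forall>m. 0 < m \<and> m < n \<longrightarrow> \<zeta> ^ m \<noteq> 1)"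

definition rho :: "complex \<Rightarrow> complex^3^3" where
  "rho \<zeta> = vector [vector [\<zeta>, 0, 0], vector [0, inverse \<zeta>, 0], vector [0, 0, 1]]"

definition epsilon :: "complex^3^3" where
  "epsilon = vector [vector [0, 1, 0], vector [1, 0, 0], vector [0, 0, -1]]"

inductive_set dihedral_group :: "complex \<Rightarrow> (complex^3^3) set" for \<zeta> :: complex where
  one: "mat 1 \<in> dihedral_group \<zeta>"
| rho: "rho \<zeta> \<in> dihedral_group \<zeta>"
| epsilon: "epsilon \<in> dihedral_group \<zeta>"
| mult: "A \<in> dihedral_group \<zeta> \<Longrightarrow> B \<in> dihedral_group \<zeta> \<Longrightarrow> A ** B \<in> dihedral_group \<zeta>"
| inverse: "A \<in> dihedral_group \<zeta> \<Longrightarrow> matrix_inv A \<in> dihedral_group \<zeta>"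

definition invariants :: "complex \<Rightarrow> 3 cpoly set" where
  "invariants \<zeta> = {f. \<forall>A\<in>dihedral_group \<zeta>. \<forall>x::complex^3.
     peval f (\<lambda>c. (A *v x) $ c) = peval f (\<lambda>c. x $ c)}"

datatype cox_var = Z1 | Z2 | Z3 | Z4 | Teps | T nat

definition vars :: "nat \<Rightarrow> cox_var set" where
  "vars k = {Z1, Z2, Z3, Z4, Teps} \<union> T ` {1..k}"

text \<open>Affine space of dimension \<open>k + 5\<close>; points are extensional functions on the variables.\<close>

definition aff :: "nat \<Rightarrow> (cox_var \<Rightarrow> complex) set" where
  "aff k = (vars k \<rightarrow>\<^sub>E UNIV)"

definition polys :: "nat \<Rightarrow> cox_var cpoly set" where
  "polys k = {F. \<forall>m\<in>Poly_Mapping.keys F. Poly_Mapping.keys m \<subseteq> vars k}"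

text \<open>The closed points of the spectrum of the Cox ring. An element of the Cox ring is
  represented by a polynomial in \<open>polys k\<close>, considered as a function on this set.\<close>

definition spec_cox :: "nat \<Rightarrow> nat \<Rightarrow> (cox_var \<Rightarrow> complex) set" where
  "spec_cox n k = {p\<in>aff k.
     p Z1 ^ 2 - p Z2 ^ 2 * p Teps - 4 * p Z3 ^ n * (\<Prod>i=1..k. p (T i) ^ (n - 2 * i)) = 0}"

text \<open>The class group is identified with the lattice of integer vectors with coordinates
  \<open>1, \<dots>, k + 1\<close>. In these coordinates, obtained from the exponents of \<open>t\<^sub>i\<close> in
  \<open>cox_embedding\<close> below on multiplying by \<open>gcd n i / n\<close>, the degrees of the variables (which
  generate the class group) span precisely that lattice, since \<open>Z4\<close> and the \<open>T i\<close> have degrees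
  \<open>e\<^sub>k\<^sub>+\<^sub>1\<close> and \<open>- e\<^sub>i\<close>. Coordinate \<open>k + 1\<close> belongs to \<open>t\<^sub>\<epsilon>\<close>.\<close>

fun deg :: "nat \<Rightarrow> cox_var \<Rightarrow> nat \<Rightarrow> int" where
  "deg k Z1 = (\<lambda>j. if j \<in> {1..k} then int j else 0)"
| "deg k Z2 = (\<lambda>j. if j \<in> {1..k} then int j else if j = k + 1 then 1 else 0)"
| "deg k Z3 = (\<lambda>j. if j \<in> {1..k} then 1 else 0)"
| "deg k Z4 = (\<lambda>j. if j = k + 1 then 1 else 0)"
| "deg k Teps = (\<lambda>j. if j = k + 1 then - 2 else 0)"
| "deg k (T i) = (\<lambda>j. if j = i then - 1 else 0)"

definition homogeneous :: "nat \<Rightarrow> (nat \<Rightarrow> int) \<Rightarrow> cox_var cpoly set" where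
  "homogeneous k d = {F\<in>polys k.
     \<forall>m\<in>Poly_Mapping.keys F.
       (\<lambda>j. \<Sum>v\<in>Poly_Mapping.keys m. int (Poly_Mapping.lookup m v) * deg k v j) = d}"

text \<open>The embedding of the Cox ring into \<open>\<complex>[x,y,z]\<^bsup>[G,G]\<^esup>[t\<^sub>\<epsilon>\<^sup>\<plusminus>\<^sup>1, t\<^sub>1\<^sup>\<plusminus>\<^sup>1, \<dots>]\<close>, as the map sending a
  point \<open>(x, t)\<close> to the values of the images of the variables there, with \<open>t\<^sub>\<epsilon> = t (k + 1)\<close>.\<close>

definition cox_embedding ::
    "nat \<Rightarrow> nat \<Rightarrow> complex^3 \<Rightarrow> (nat \<Rightarrow> complex) \<Rightarrow> cox_var \<Rightarrow> complex" where
  "cox_embedding n k x t = (\<lambda>v\<in>vars k. case v of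
       Z1 \<Rightarrow> (x$1 ^ n + x$2 ^ n) * (\<Prod>i=1..k. t i ^ (i * n div gcd n i))
     | Z2 \<Rightarrow> (x$1 ^ n - x$2 ^ n) * t (k + 1) * (\<Prod>i=1..k. t i ^ (i * n div gcd n i))
     | Z3 \<Rightarrow> x$1 * x$2 * (\<Prod>i=1..k. t i ^ (n div gcd n i))
     | Z4 \<Rightarrow> x$3 * t (k + 1)
     | Teps \<Rightarrow> t (k + 1) powi (- 2)
     | T i \<Rightarrow> t i powi (- int (n div gcd n i)))"

text \<open>The fibre of the map from the spectrum of the Cox ring to the spectrum of the ring of
  invariants over the class of the origin. The ring of invariants is identified with the degree
  zero part of the Cox ring: an invariant \<open>f\<close> corresponds to the degree zero element \<open>F\<close> whose
  image under the embedding is \<open>f\<close>, and \<open>p\<close> lies over the class of the origin iff always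
  \<open>F(p) = f(0)\<close>.\<close>

definition central_fibre :: "nat \<Rightarrow> nat \<Rightarrow> complex \<Rightarrow> (cox_var \<Rightarrow> complex) set" where
  "central_fibre n k \<zeta> = {p\<in>spec_cox n k.
     \<forall>f\<in>invariants \<zeta>. \<forall>F\<in>homogeneous k (\<lambda>_. 0).
       (\<forall>x t. (\<forall>j\<in>{1..k+1}. t j \<noteq> 0) \<longrightarrow>
          peval F (cox_embedding n k x t) = peval f (\<lambda>c. x $ c))
       \<longrightarrow> peval F p = peval f (\<lambda>c. 0)}"

definition zariski_closed :: "nat \<Rightarrow> (cox_var \<Rightarrow> complex) set \<Rightarrow> bool" where
  "zariski_closed k C \<longleftrightarrow> (\<exists>\<F>\<subseteq>polys k. C = {p\<in>aff k. \<forall>F\<in>\<F>. peval F p = 0})"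

definition zariski_irreducible :: "nat \<Rightarrow> (cox_var \<Rightarrow> complex) set \<Rightarrow> bool" where
  "zariski_irreducible k S \<longleftrightarrow> S \<noteq> {} \<and> S \<subseteq> aff k \<and>
     (\<forall>A B. zariski_closed k A \<and> zariski_closed k B \<and> S \<subseteq> A \<union> B \<longrightarrow> S \<subseteq> A \<or> S \<subseteq> B)"

definition irreducible_components ::
    "nat \<Rightarrow> (cox_var \<Rightarrow> complex) set \<Rightarrow> (cox_var \<Rightarrow> complex) set set" where
  "irreducible_components k S = {C. C \<subseteq> S \<and> zariski_irreducible k C \<and>
     (\<forall>D. C \<subseteq> D \<and> D \<subseteq> S \<and> zariski_irreducible k D \<longrightarrow> D = C)}"

text \<open>Homomorphisms from the class group to the multiplicative group.\<close>

definition torus :: "nat \<Rightarrow> (nat \<Rightarrow> complex) set" where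
  "torus k = ({1..k+1} \<rightarrow>\<^sub>E (UNIV - {0}))"

definition torus_act ::
    "nat \<Rightarrow> (nat \<Rightarrow> complex) \<Rightarrow> (cox_var \<Rightarrow> complex) \<Rightarrow> (cox_var \<Rightarrow> complex)" where
  "torus_act k s p = (\<lambda>v\<in>vars k. (\<Prod>j=1..k+1. s j powi deg k v j) * p v)"

text \<open>The linearisation of the trivial line bundle given by the character \<open>\<theta>\<close>: the invariant
  sections of its \<open>m\<close>-th power are the elements of the Cox ring of degree \<open>m \<theta>\<close>. As the
  defining relation of the Cox ring is homogeneous, they are represented by homogeneous
  polynomials.\<close>

definition semistable :: "nat \<Rightarrow> nat \<Rightarrow> (nat \<Rightarrow> int) \<Rightarrow> (cox_var \<Rightarrow> complex) set" where
  "semistable n k \<theta> = {p\<in>spec_cox n k.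
     \<exists>m\<ge>1. \<exists>F\<in>homogeneous k (\<lambda>j. int m * \<theta> j). peval F p \<noteq> 0}"

text \<open>Stable means semistable with finite stabiliser and with orbit closed in the semistable
  locus (Mumford's proper stability).\<close>

definition stable :: "nat \<Rightarrow> nat \<Rightarrow> (nat \<Rightarrow> int) \<Rightarrow> (cox_var \<Rightarrow> complex) set" where
  "stable n k \<theta> = {p\<in>semistable n k \<theta>.
     finite {s\<in>torus k. torus_act k s p = p} \<and>
     (\<exists>C. zariski_closed k C \<and>
          (\<lambda>s. torus_act k s p) ` torus k = C \<inter> semistable n k \<theta>)}"

text \<open>A general point of \<open>C\<close> is stable: all points of some nonempty relatively Zariski open
  subset \<open>C - B\<close> of \<open>C\<close> are.\<close>

definition generically_stable ::
    "nat \<Rightarrow> nat \<Rightarrow> (nat \<Rightarrow> int) \<Rightarrow> (cox_var \<Rightarrow> complex) set \<Rightarrow> bool" where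
  "generically_stable n k \<theta> C \<longleftrightarrow>
     (\<exists>B. zariski_closed k B \<and> C - B \<noteq> {} \<and> C - B \<subseteq> stable n k \<theta>)"

definition stable_components ::
    "nat \<Rightarrow> nat \<Rightarrow> complex \<Rightarrow> (nat \<Rightarrow> int) \<Rightarrow> (cox_var \<Rightarrow> complex) set set" where
  "stable_components n k \<zeta> \<theta> =
     {C\<in>irreducible_components k (central_fibre n k \<zeta>). generically_stable n k \<theta> C}"

definition grading_space :: "nat \<Rightarrow> (nat \<Rightarrow> real) set" where
  "grading_space k = {x. \<forall>j. j \<notin> {1..k+1} \<longrightarrow> x j = 0}"

definition q_vec :: "nat \<Rightarrow> nat \<Rightarrow> real" where
  "q_vec k = (\<lambda>j. if j = k + 1 then 1 else 0)"

definition v_vec :: "nat \<Rightarrow> nat \<Rightarrow> nat \<Rightarrow> real" where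
  "v_vec k i = (\<lambda>j. if j \<in> {1..k} then real (min j i) else 0)"

definition w_vec :: "nat \<Rightarrow> nat \<Rightarrow> nat \<Rightarrow> real" where
  "w_vec k i = (\<lambda>j. v_vec k i j + q_vec k j)"

definition fcone :: "(nat \<Rightarrow> real) set \<Rightarrow> (nat \<Rightarrow> real) set" where
  "fcone S = {x. \<exists>a. (\<forall>u\<in>S. a u \<ge> 0) \<and> x = (\<lambda>j. \<Sum>u\<in>S. a u * u j)}"

definition chamber :: "nat \<Rightarrow> nat \<Rightarrow> (nat \<Rightarrow> real) set" where
  "chamber k i = (if i = 0 then fcone (insert (q_vec k) (w_vec k ` {1..k}))
                  else fcone (v_vec k ` {1..i} \<union> w_vec k ` {i..k}))"

text \<open>The characters in the interior of the \<open>i\<close>-th chamber, the interior being taken in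
  \<open>grading_space k\<close>, whose subspace topology in the product space is the Euclidean one. The
  crepant resolution \<open>X\<^sub>i\<close> is the GIT quotient of \<open>spec_cox n k\<close> by \<open>torus k\<close> linearised by
  any of these.\<close>

definition linearisations :: "nat \<Rightarrow> nat \<Rightarrow> (nat \<Rightarrow> int) set" where
  "linearisations k i =
     {\<theta>. (\<lambda>j. real_of_int (\<theta> j)) \<in> (top_of_set (grading_space k)) interior_of (chamber k i)}"

definition W_comp :: "nat \<Rightarrow> nat \<Rightarrow> nat \<Rightarrow> (cox_var \<Rightarrow> complex) set" where
  "W_comp n k j = {p\<in>spec_cox n k. p Z4 = 0 \<and> p (T j) = 0 \<and> p Z1 ^ 2 - p Z2 ^ 2 * p Teps = 0}"

definition W'_comp :: "nat \<Rightarrow> nat \<Rightarrow> nat \<Rightarrow> (cox_var \<Rightarrow> complex) set" where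
  "W'_comp n k j = {p\<in>spec_cox n k. p Z1 = 0 \<and> p Teps = 0 \<and> p (T j) = 0}"

definition W0_comp :: "nat \<Rightarrow> nat \<Rightarrow> (cox_var \<Rightarrow> complex) set" where
  "W0_comp n k = {p\<in>spec_cox n k. p Z1 = 0 \<and> p Z3 = 0 \<and> p Teps = 0}"

definition Wu_comp :: "nat \<Rightarrow> nat \<Rightarrow> (cox_var \<Rightarrow> complex) set" where
  "Wu_comp n k = {p\<in>spec_cox n k. p Z1 = 0 \<and> p Z2 = 0 \<and> p Z3 = 0 \<and> p Z4 = 0}"

end

theory Submission
  imports Defs "HOL-Computational_Algebra.Polynomial"
begin

text \<open>The degree zero part of the Cox ring is spanned by monomials, and the nonconstant ones all
  vanish at a point iff \<open>Z3 \<Prod>T\<^sub>i\<close>, \<open>Z1 \<Prod>T\<^sub>i\<close>, \<open>Z4 Teps\<close> and \<open>Z2 Teps \<Prod>T\<^sub>i\<close> do; this gives the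
  central fibre and its components. A point whose nonvanishing variables have degrees generating
  the lattice is stable as soon as \<open>\<theta>\<close> is a positive rational combination of all these degrees.
  With \<open>\<theta>\<^sub>0 = 0\<close>, the interior of the chamber \<open>\<sigma>\<^sub>l\<close> lies in the set where \<open>\<theta>\<^sub>1, \<dots>, \<theta>\<^sub>k\<close> has
  decreasing positive increments \<open>D\<^sub>1 > \<dots> > D\<^sub>k > 0\<close> and \<open>D\<^sub>l > \<theta>\<^sub>k\<^sub>+\<^sub>1 > D\<^sub>l\<^sub>+\<^sub>1\<close>. A positive combination
  of the degrees on \<open>W\<^sub>j\<close> or \<open>W'\<^sub>j\<close> amounts to a line supporting the graph of the concave function
  \<open>i \<mapsto> \<theta>\<^sub>i\<close> exactly at \<open>j\<close>, whose slope is larger, respectively smaller, than \<open>\<theta>\<^sub>k\<^sub>+\<^sub>1\<close>.\<close>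

section \<open>Monomials and their degrees\<close>

text \<open>Terms outside the support have coefficient zero. A common index set is what allows
  polynomials with different supports to be added.\<close>

lemma peval_superset:
  assumes "finite K" "Poly_Mapping.keys F \<subseteq> K"
  shows "peval F p = (\<Sum>m\<in>K. Poly_Mapping.lookup F m *
           (\<Prod>v\<in>Poly_Mapping.keys m. p v ^ Poly_Mapping.lookup m v))"
  unfolding peval_def
  by (rule sum.mono_neutral_left) (use assms in \<open>auto simp: in_keys_iff\<close>)

lemma peval_add: "peval (F + G) p = peval F p + peval G p"
proof -
  have K: "finite (Poly_Mapping.keys F \<union> Poly_Mapping.keys G)" by simp
  show ?thesis
    unfolding peval_superset[OF K keys_add] peval_superset[OF K Un_upper1] peval_superset[OF K Un_upper2]
    by (simp add: lookup_add distrib_right sum.distrib)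
qed

lemma peval_single:
  "peval (Poly_Mapping.single m c) p =
     c * (\<Prod>v\<in>Poly_Mapping.keys m. p v ^ Poly_Mapping.lookup m v)"
  by (auto simp: peval_def)

lemma prod_keys_superset:
  fixes p :: "'v \<Rightarrow> complex"
  assumes "finite K" "Poly_Mapping.keys m \<subseteq> K"
  shows "(\<Prod>v\<in>Poly_Mapping.keys m. p v ^ Poly_Mapping.lookup m v) = (\<Prod>v\<in>K. p v ^ Poly_Mapping.lookup m v)"
  by (rule prod.mono_neutral_left) (use assms in \<open>auto simp: in_keys_iff\<close>)

lemma finite_vars [simp]: "finite (vars k)"
  by (simp add: vars_def)

lemma sum_vars:
  "(\<Sum>v\<in>vars k. g v) = g Z1 + g Z2 + g Z3 + g Z4 + g Teps + (\<Sum>i=1..k. g (T i))"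
  for g :: "cox_var \<Rightarrow> 'a::comm_monoid_add"
proof -
  have "sum g (T ` {1..k}) = (\<Sum>i=1..k. g (T i))"
    by (subst sum.reindex) (auto simp: inj_on_def)
  moreover have "sum g (vars k) = sum g {Z1, Z2, Z3, Z4, Teps} + sum g (T ` {1..k})"
    unfolding vars_def by (rule sum.union_disjoint) auto
  ultimately show ?thesis by (simp add: add.assoc)
qed

lemma prod_vars:
  "(\<Prod>v\<in>vars k. g v) = g Z1 * g Z2 * g Z3 * g Z4 * g Teps * (\<Prod>i=1..k. g (T i))"
  for g :: "cox_var \<Rightarrow> 'a::comm_monoid_mult"
proof -
  have "prod g (T ` {1..k}) = (\<Prod>i=1..k. g (T i))"
    by (subst prod.reindex) (auto simp: inj_on_def)
  moreover have "prod g (vars k) = prod g {Z1, Z2, Z3, Z4, Teps} * prod g (T ` {1..k})"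
    unfolding vars_def by (rule prod.union_disjoint) auto
  ultimately show ?thesis by (simp add: mult.assoc)
qed

lemma ball_vars:
  "(\<forall>v\<in>vars k. P v) \<longleftrightarrow> P Z1 \<and> P Z2 \<and> P Z3 \<and> P Z4 \<and> P Teps \<and> (\<forall>i\<in>{1..k}. P (T i))"
  by (auto simp: vars_def)

lemma vars_mem [simp]:
  "Z1 \<in> vars k" "Z2 \<in> vars k" "Z3 \<in> vars k" "Z4 \<in> vars k" "Teps \<in> vars k"
  "T i \<in> vars k \<longleftrightarrow> i \<in> {1..k}"
  by (auto simp: vars_def)

text \<open>Exponents are plain functions whose values outside \<open>vars k\<close> are ignored, so
  an exponent vector can be given by cases on the variables.\<close>

definition monomial_value :: "nat \<Rightarrow> (cox_var \<Rightarrow> nat) \<Rightarrow> (cox_var \<Rightarrow> complex) \<Rightarrow> complex" where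
  "monomial_value k a p = (\<Prod>v\<in>vars k. p v ^ a v)"

definition cox_monom :: "nat \<Rightarrow> (cox_var \<Rightarrow> nat) \<Rightarrow> complex \<Rightarrow> cox_var cpoly" where
  "cox_monom k a c =
     Poly_Mapping.single (Abs_poly_mapping (\<lambda>v. if v \<in> vars k then a v else 0)) c"

text \<open>The coefficients are integers, so that Laurent monomials and linear relations among the
  degrees are covered as well.\<close>

definition total_deg :: "nat \<Rightarrow> (cox_var \<Rightarrow> int) \<Rightarrow> nat \<Rightarrow> int" where
  "total_deg k c = (\<lambda>j. \<Sum>v\<in>vars k. c v * deg k v j)"

lemma lookup_exponent:
  "Poly_Mapping.lookup (Abs_poly_mapping (\<lambda>v. if v \<in> vars k then a v else 0)) =
     (\<lambda>v. if v \<in> vars k then a v else (0::nat))"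
  by (rule lookup_Abs_poly_mapping) (rule finite_subset[of _ "vars k"], auto)

lemma keys_exponent:
  "Poly_Mapping.keys (Abs_poly_mapping (\<lambda>v. if v \<in> vars k then a v else (0::nat))) \<subseteq> vars k"
  by (auto simp: in_keys_iff lookup_exponent split: if_splits)

lemma cox_monom_polys [simp]: "cox_monom k a c \<in> polys k"
  using keys_exponent[of k a] by (auto simp: polys_def cox_monom_def split: if_splits)

lemma peval_cox_monom [simp]: "peval (cox_monom k a c) p = c * monomial_value k a p"
  unfolding cox_monom_def peval_single monomial_value_def
  by (subst prod_keys_superset[OF finite_vars keys_exponent])
     (auto simp: lookup_exponent intro!: prod.cong)

lemma cox_monom_homogeneous:
  assumes "total_deg k (\<lambda>v. int (a v)) = d"
  shows "cox_monom k a c \<in> homogeneous k d"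
proof -
  let ?m = "Abs_poly_mapping (\<lambda>v. if v \<in> vars k then a v else 0)"
  have "(\<Sum>v\<in>Poly_Mapping.keys ?m. int (Poly_Mapping.lookup ?m v) * deg k v j) =
        (\<Sum>v\<in>vars k. int (Poly_Mapping.lookup ?m v) * deg k v j)" for j
    by (rule sum.mono_neutral_left) (use keys_exponent[of k a] in \<open>auto simp: in_keys_iff\<close>)
  also have "\<dots> j = d j" for j
    unfolding assms[symmetric] total_deg_def by (rule sum.cong) (auto simp: lookup_exponent)
  finally have "(\<lambda>j. \<Sum>v\<in>Poly_Mapping.keys ?m. int (Poly_Mapping.lookup ?m v) * deg k v j) = d"
    by blast
  then show ?thesis
    using cox_monom_polys[of k a c]
    unfolding homogeneous_def by (auto simp: cox_monom_def split: if_splits)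
qed

lemma polys_add:
  assumes "F \<in> polys k" "G \<in> polys k"
  shows "F + G \<in> polys k"
  using assms keys_add[of F G] unfolding polys_def by blast

lemma homogeneous_key:
  assumes "F \<in> homogeneous k d" "m \<in> Poly_Mapping.keys F"
  shows "total_deg k (\<lambda>v. int (Poly_Mapping.lookup m v)) = d"
    and "(\<Prod>v\<in>Poly_Mapping.keys m. p v ^ Poly_Mapping.lookup m v) =
           monomial_value k (Poly_Mapping.lookup m) p"
    and "Poly_Mapping.keys m \<subseteq> vars k"
proof -
  show sub: "Poly_Mapping.keys m \<subseteq> vars k"
    using assms by (auto simp: homogeneous_def polys_def)
  show "(\<Prod>v\<in>Poly_Mapping.keys m. p v ^ Poly_Mapping.lookup m v) =
           monomial_value k (Poly_Mapping.lookup m) p"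
    unfolding monomial_value_def by (rule prod_keys_superset) (use sub in auto)
  have "(\<lambda>j. \<Sum>v\<in>Poly_Mapping.keys m. int (Poly_Mapping.lookup m v) * deg k v j) = d"
    using assms by (auto simp: homogeneous_def)
  moreover have "(\<Sum>v\<in>Poly_Mapping.keys m. int (Poly_Mapping.lookup m v) * deg k v j) =
     total_deg k (\<lambda>v. int (Poly_Mapping.lookup m v)) j" for j
    unfolding total_deg_def
    by (rule sum.mono_neutral_left) (use sub in \<open>auto simp: in_keys_iff\<close>)
  ultimately show "total_deg k (\<lambda>v. int (Poly_Mapping.lookup m v)) = d" by simp
qed

text \<open>A nonzero sum has a nonzero summand. This reduces questions about homogeneous elements
  to monomials.\<close>

lemma homogeneous_nonzeroE:
  assumes "F \<in> homogeneous k d" "peval F p \<noteq> 0"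
  obtains a where "total_deg k (\<lambda>v. int (a v)) = d" "monomial_value k a p \<noteq> 0"
proof -
  obtain m where m: "m \<in> Poly_Mapping.keys F"
      and "(\<Prod>v\<in>Poly_Mapping.keys m. p v ^ Poly_Mapping.lookup m v) \<noteq> 0"
    using assms(2) unfolding peval_def by (metis (no_types, lifting) mult_zero_right sum.neutral)
  with homogeneous_key[OF assms(1) m] show ?thesis by (metis that)
qed

lemma monomial_value_nonzero:
  "monomial_value k a p \<noteq> 0 \<longleftrightarrow> (\<forall>v\<in>vars k. a v > 0 \<longrightarrow> p v \<noteq> 0)"
  by (auto simp: monomial_value_def)

lemma total_deg_T:
  assumes "j \<in> {1..k}"
  shows "total_deg k c j = int j * (c Z1 + c Z2) + c Z3 - c (T j)"
proof -
  have "(\<Sum>i=1..k. c (T i) * (if j = i then - 1 else 0)) = (\<Sum>i=1..k. if j = i then - c (T i) else 0)"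
    by (rule sum.cong) auto
  also have "\<dots> = - c (T j)" using assms by simp
  finally show ?thesis
    using assms by (auto simp: total_deg_def sum_vars algebra_simps)
qed

lemma total_deg_eps:
  "total_deg k c (k + 1) = c Z2 + c Z4 - 2 * c Teps"
proof -
  have "(\<Sum>i=1..k. c (T i) * (if k + 1 = i then - 1 else 0)) = 0"
    by (rule sum.neutral) auto
  then show ?thesis by (auto simp: total_deg_def sum_vars algebra_simps)
qed

lemma total_deg_outside:
  assumes "j \<notin> {1..k+1}"
  shows "total_deg k c j = 0"
proof -
  have "(\<Sum>i=1..k. c (T i) * (if j = i then - 1 else 0)) = 0"
    by (rule sum.neutral) (use assms in auto)
  then show ?thesis using assms by (auto simp: total_deg_def sum_vars algebra_simps)
qed

text \<open>Every later degree computation goes through these three kinds of coordinates: outside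
  the grading group, the one of \<open>t\<^sub>\<epsilon>\<close>, and those lowered by exactly one
  \<open>T j\<close>.\<close>

lemma total_deg_eqI:
  assumes "\<And>j. j \<notin> {1..k+1} \<Longrightarrow> d j = 0"
    and "d (k + 1) = c Z2 + c Z4 - 2 * c Teps"
    and "\<And>j. j \<in> {1..k} \<Longrightarrow> d j = int j * (c Z1 + c Z2) + c Z3 - c (T j)"
  shows "total_deg k c = d"
proof
  fix j
  consider "j \<notin> {1..k+1}" | "j = k + 1" | "j \<in> {1..k}" by fastforce
  then show "total_deg k c j = d j"
    using assms total_deg_T total_deg_eps total_deg_outside by cases metis+
qed

section \<open>Characters of the torus and its action on monomials\<close>

lemma power_int_sum:
  fixes x :: "'a::field"
  assumes "x \<noteq> 0"
  shows "x powi (\<Sum>i\<in>A. f i) = (\<Prod>i\<in>A. x powi f i)"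
  by (induction A rule: infinite_finite_induct) (use assms in \<open>auto simp: power_int_add\<close>)

lemma prod_power_int:
  fixes f :: "'a \<Rightarrow> 'b::field"
  shows "(\<Prod>i\<in>A. f i) powi m = (\<Prod>i\<in>A. f i powi m)"
  by (induction A rule: infinite_finite_induct) (auto simp: power_int_mult_distrib)

definition character :: "nat \<Rightarrow> (nat \<Rightarrow> complex) \<Rightarrow> (nat \<Rightarrow> int) \<Rightarrow> complex" where
  "character k s d = (\<Prod>j=1..k+1. s j powi d j)"

lemma torus_nonzero: "s \<in> torus k \<Longrightarrow> j \<in> {1..k+1} \<Longrightarrow> s j \<noteq> 0"
  by (auto simp: torus_def PiE_iff)

lemma character_nonzero: "s \<in> torus k \<Longrightarrow> character k s d \<noteq> 0"
  using torus_nonzero unfolding character_def by (auto simp: power_int_eq_0_iff)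

lemma torus_act_eq: "v \<in> vars k \<Longrightarrow> torus_act k s p v = character k s (deg k v) * p v"
  by (simp add: torus_act_def character_def)

lemma torus_act_aff: "torus_act k s p \<in> aff k"
  by (auto simp: torus_act_def aff_def)

text \<open>Characters turn sums of degrees into products; negative exponents cause no trouble
  because the entries of \<open>s\<close> are nonzero. The rest is an interchange of two
  products.\<close>

lemma character_total_deg:
  assumes "s \<in> torus k"
  shows "character k s (total_deg k c) = (\<Prod>v\<in>vars k. character k s (deg k v) powi c v)"
proof -
  have "character k s (total_deg k c) = (\<Prod>j=1..k+1. \<Prod>v\<in>vars k. s j powi (c v * deg k v j))"
    unfolding character_def total_deg_def
    by (intro prod.cong refl power_int_sum torus_nonzero[OF assms])
  also have "\<dots> = (\<Prod>v\<in>vars k. \<Prod>j=1..k+1. s j powi (c v * deg k v j))"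
    by (rule prod.swap)
  also have "\<dots> = (\<Prod>v\<in>vars k. character k s (deg k v) powi c v)"
    unfolding character_def prod_power_int
    by (simp only: power_int_mult[symmetric] mult.commute)
  finally show ?thesis .
qed

lemma monomial_value_torus_act:
  assumes "s \<in> torus k"
  shows "monomial_value k a (torus_act k s p) =
           character k s (total_deg k (\<lambda>v. int (a v))) * monomial_value k a p"
  unfolding character_total_deg[OF assms] monomial_value_def
  by (simp add: torus_act_eq power_mult_distrib prod.distrib)

section \<open>Stable points\<close>

text \<open>By \<open>homogeneous_nonzeroE\<close> monomials suffice, so on
  \<open>spec_cox n k\<close> semistability depends only on which coordinates vanish.\<close>

lemma semistable_iff:
  "p \<in> semistable n k \<theta> \<longleftrightarrow> p \<in> spec_cox n k \<and>
     (\<exists>m\<ge>1. \<exists>a. total_deg k (\<lambda>v. int (a v)) = (\<lambda>j. int m * \<theta> j) \<and> monomial_value k a p \<noteq> 0)"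
  (is "_ \<longleftrightarrow> _ \<and> (\<exists>m\<ge>1. ?Q m)")
proof -
  have "(\<exists>F\<in>homogeneous k (\<lambda>j. int m * \<theta> j). peval F p \<noteq> 0) \<longleftrightarrow> ?Q m" for m
  proof
    assume "\<exists>F\<in>homogeneous k (\<lambda>j. int m * \<theta> j). peval F p \<noteq> 0"
    then show "?Q m" by (metis homogeneous_nonzeroE)
  next
    assume "?Q m"
    then obtain a where "total_deg k (\<lambda>v. int (a v)) = (\<lambda>j. int m * \<theta> j)"
      and "monomial_value k a p \<noteq> 0" by blast
    then show "\<exists>F\<in>homogeneous k (\<lambda>j. int m * \<theta> j). peval F p \<noteq> 0"
      by (intro bexI[of _ "cox_monom k a 1"] cox_monom_homogeneous) auto
  qed
  then show ?thesis by (auto simp: semistable_def)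
qed

lemma relation_monomials:
  "monomial_value k ((\<lambda>_. 0)(Z1 := 2)) p = p Z1 ^ 2"
  "monomial_value k ((\<lambda>_. 0)(Z2 := 2, Teps := 1)) p = p Z2 ^ 2 * p Teps"
  "monomial_value k (\<lambda>v. case v of Z3 \<Rightarrow> n | T i \<Rightarrow> n - 2 * i | _ \<Rightarrow> 0) p =
     p Z3 ^ n * (\<Prod>i=1..k. p (T i) ^ (n - 2 * i))"
  by (simp_all add: monomial_value_def prod_vars)

text \<open>The three terms of the relation have the common degree 2 (1, ..., k, 0), so the torus
  multiplies the relation by a character. For the last term this is n - (n - 2 j) = 2 j, and n = 2 k
  + 1 keeps the natural subtraction exact.\<close>

lemma spec_cox_torus_act:
  assumes "n = 2 * k + 1" "p \<in> spec_cox n k" "s \<in> torus k"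
  shows "torus_act k s p \<in> spec_cox n k"
proof -
  define d :: "nat \<Rightarrow> int" where "d = (\<lambda>j. if j \<in> {1..k} then 2 * int j else 0)"
  have d: "total_deg k (\<lambda>v. int (((\<lambda>_. 0)(Z1 := 2)) v)) = d"
    "total_deg k (\<lambda>v. int (((\<lambda>_. 0)(Z2 := 2, Teps := 1)) v)) = d"
    "total_deg k (\<lambda>v. int (case v of Z3 \<Rightarrow> n | T i \<Rightarrow> n - 2 * i | _ \<Rightarrow> 0)) = d"
    by (rule total_deg_eqI; use assms(1) in \<open>auto simp: d_def of_nat_diff\<close>)+
  let ?r = "torus_act k s p"
  have "?r Z1 ^ 2 - ?r Z2 ^ 2 * ?r Teps - 4 * ?r Z3 ^ n * (\<Prod>i=1..k. ?r (T i) ^ (n - 2 * i)) =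
     character k s d * (p Z1 ^ 2 - p Z2 ^ 2 * p Teps - 4 * p Z3 ^ n * (\<Prod>i=1..k. p (T i) ^ (n - 2 * i)))"
  proof -
    have "?r Z1 ^ 2 = character k s d * p Z1 ^ 2"
      "?r Z2 ^ 2 * ?r Teps = character k s d * (p Z2 ^ 2 * p Teps)"
      "?r Z3 ^ n * (\<Prod>i=1..k. ?r (T i) ^ (n - 2 * i)) =
         character k s d * (p Z3 ^ n * (\<Prod>i=1..k. p (T i) ^ (n - 2 * i)))"
      using d monomial_value_torus_act[OF assms(3), of "(\<lambda>_. 0)(Z1 := 2)" p]
        monomial_value_torus_act[OF assms(3), of "(\<lambda>_. 0)(Z2 := 2, Teps := 1)" p]
        monomial_value_torus_act[OF assms(3), of "\<lambda>v. case v of Z3 \<Rightarrow> n | T i \<Rightarrow> n - 2 * i | _ \<Rightarrow> 0" p]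
      unfolding relation_monomials by simp_all
    then show ?thesis by (simp add: algebra_simps)
  qed
  then show ?thesis using assms(2) by (simp add: spec_cox_def torus_act_aff)
qed

text \<open>An element fixing \<open>p\<close> has character value one on the degree of each
  nonvanishing variable. Each unit vector is an integer combination of these degrees, so each entry
  of \<open>s\<close> is one.\<close>

lemma stabiliser_trivial:
  assumes "s \<in> torus k" "torus_act k s p = p"
    and "\<And>j. j \<in> {1..k+1} \<Longrightarrow> \<exists>c. (\<forall>v\<in>vars k. p v = 0 \<longrightarrow> c v = 0) \<and>
           total_deg k c = (\<lambda>i. if i = j then 1 else 0)"
  shows "s = (\<lambda>j\<in>{1..k+1}. 1)"
proof
  fix j
  show "s j = (\<lambda>j\<in>{1..k+1}. 1) j"
  proof (cases "j \<in> {1..k+1}")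
    case True
    obtain c where c: "\<forall>v\<in>vars k. p v = 0 \<longrightarrow> c v = 0"
      "total_deg k c = (\<lambda>i. if i = j then 1 else 0)"
      using assms(3)[OF True] by blast
    have "character k s (deg k v) powi c v = 1" if "v \<in> vars k" for v
    proof (cases "p v = 0")
      case False
      then have "character k s (deg k v) = 1"
        using torus_act_eq[OF that, of s p] assms(2) by simp
      then show ?thesis by simp
    qed (use c that in simp)
    then have "character k s (total_deg k c) = 1"
      unfolding character_total_deg[OF assms(1)] by simp
    moreover have "character k s (total_deg k c) = (\<Prod>i=1..k+1. if i = j then s i else 1)"
      unfolding character_def c(2) by (rule prod.cong) auto
    moreover have "\<dots> = s j" using True by simp
    ultimately show ?thesis using True by simp
  next
    case False
    then show ?thesis using assms(1) by (auto simp: torus_def PiE_def extensional_def)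
  qed
qed

lemma monomial_value_power:
  "monomial_value k (\<lambda>v. m * a v) p = monomial_value k a p ^ m"
  by (simp add: monomial_value_def prod_power_distrib power_mult[symmetric] mult.commute)

text \<open>The positive and negative parts of \<open>c\<close> are exponents of two monomials of
  equal degree. The binomial equation for this pair says that the Laurent monomial \<open>c\<close>
  has the same value at \<open>p\<close> and \<open>r\<close>.\<close>

lemma binomial_imp_power_int:
  assumes "\<And>a b. total_deg k (\<lambda>v. int (a v)) = total_deg k (\<lambda>v. int (b v)) \<Longrightarrow>
             monomial_value k b p * monomial_value k a r = monomial_value k a p * monomial_value k b r"
    and "\<And>v. v \<in> vars k \<Longrightarrow> c v \<noteq> 0 \<Longrightarrow> p v \<noteq> 0 \<and> r v \<noteq> 0"
    and "total_deg k c = (\<lambda>_. 0)"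
  shows "(\<Prod>v\<in>vars k. (r v / p v) powi c v) = 1"
proof -
  define a where "a v = nat (c v)" for v
  define b where "b v = nat (- c v)" for v
  have cab: "c v = int (a v) - int (b v)" for v by (simp add: a_def b_def)
  have "total_deg k (\<lambda>v. int (a v)) j - total_deg k (\<lambda>v. int (b v)) j = total_deg k c j" for j
    unfolding total_deg_def sum_subtractf[symmetric] by (simp add: cab algebra_simps)
  then have "total_deg k (\<lambda>v. int (a v)) = total_deg k (\<lambda>v. int (b v))"
    using assms(3) by auto
  from assms(1)[OF this]
  have eq: "monomial_value k b p * monomial_value k a r = monomial_value k a p * monomial_value k b r" .
  have nz: "monomial_value k b p \<noteq> 0" "monomial_value k a p \<noteq> 0" "monomial_value k b r \<noteq> 0"
    using assms(2) by (auto simp: monomial_value_nonzero a_def b_def)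
  have "(r v / p v) powi c v = (r v ^ a v * p v ^ b v) / (p v ^ a v * r v ^ b v)"
    if "v \<in> vars k" for v
  proof (cases "c v \<ge> 0")
    case True
    then have "b v = 0" "c v = int (a v)" by (auto simp: a_def b_def)
    then show ?thesis by (simp add: power_divide)
  next
    case False
    then have "a v = 0" "c v = - int (b v)" by (auto simp: a_def b_def)
    then show ?thesis by (simp add: power_divide power_int_minus)
  qed
  then have "(\<Prod>v\<in>vars k. (r v / p v) powi c v) =
      (monomial_value k a r * monomial_value k b p) / (monomial_value k a p * monomial_value k b r)"
    by (simp add: monomial_value_def prod_dividef prod.distrib)
  also have "\<dots> = 1" using eq nz by (simp add: field_simps)
  finally show ?thesis .
qed

lemma deg_outside: "v \<in> vars k \<Longrightarrow> j \<notin> {1..k+1} \<Longrightarrow> deg k v j = 0"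
  by (cases v) auto

text \<open>The torus element is read off from the ratios \<open>r v / p v\<close>: its entry
  \<open>j\<close> is the Laurent monomial in these ratios that has degree the unit vector at
  \<open>j\<close>. The binomial equations make this choice consistent with every
  coordinate.\<close>

lemma in_orbit_if_binomials:
  assumes bin: "\<And>a b. total_deg k (\<lambda>v. int (a v)) = total_deg k (\<lambda>v. int (b v)) \<Longrightarrow>
             monomial_value k b p * monomial_value k a r = monomial_value k a p * monomial_value k b r"
    and supp: "\<And>v. v \<in> vars k \<Longrightarrow> p v = 0 \<longleftrightarrow> r v = 0"
    and r: "r \<in> aff k"
    and gen: "\<And>j. j \<in> {1..k+1} \<Longrightarrow> \<exists>c. (\<forall>v\<in>vars k. p v = 0 \<longrightarrow> c v = 0) \<and>
           total_deg k c = (\<lambda>i. if i = j then 1 else 0)"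
  shows "r \<in> (\<lambda>s. torus_act k s p) ` torus k"
proof -
  obtain c where c: "\<And>j v. j \<in> {1..k+1} \<Longrightarrow> v \<in> vars k \<Longrightarrow> p v = 0 \<Longrightarrow> c j v = 0"
    "\<And>j. j \<in> {1..k+1} \<Longrightarrow> total_deg k (c j) = (\<lambda>i. if i = j then 1 else 0)"
    using gen by metis
  define s where "s = (\<lambda>j\<in>{1..k+1}. \<Prod>v\<in>vars k. (r v / p v) powi c j v)"
  have s: "s \<in> torus k"
    unfolding torus_def s_def using c supp by (auto simp: power_int_eq_0_iff)
  have "character k s (deg k w) * p w = r w" if w: "w \<in> vars k" for w
  proof (cases "p w = 0")
    case True
    then show ?thesis using supp[OF w] by simp
  next
    case False
    then have rw: "r w \<noteq> 0" using supp[OF w] by simp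
    \<comment> \<open>Expanding the degree of \<open>w\<close> in unit vectors gives the exponent
      \<open>e\<close>, which has the degree of \<open>w\<close>. So \<open>d\<close> has degree
      zero, and the Laurent monomial \<open>e\<close> in the ratios differs from
      \<open>r w / p w\<close> by a factor one.\<close>
    define e where "e v = (\<Sum>j=1..k+1. c j v * deg k w j)" for v
    define d where "d v = e v - (if v = w then 1 else 0)" for v
    have e0: "e v = 0" if "v \<in> vars k" "p v = 0" for v
      unfolding e_def by (rule sum.neutral) (use c that in auto)
    have "total_deg k d i = 0" for i
    proof -
      have "(\<Sum>v\<in>vars k. e v * deg k v i) = (\<Sum>j=1..k+1. deg k w j * total_deg k (c j) i)"
        unfolding e_def total_deg_def sum_distrib_right sum_distrib_left
        by (subst sum.swap) (simp add: mult_ac)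
      also have "\<dots> = (\<Sum>j=1..k+1. if j = i then deg k w j else 0)"
        by (rule sum.cong) (use c(2) in auto)
      also have "\<dots> = deg k w i"
        by (cases "i \<in> {1..k+1}") (simp, metis deg_outside[OF w] sum.delta finite_atLeastAtMost)
      finally have "(\<Sum>v\<in>vars k. e v * deg k v i) = deg k w i" .
      moreover have "(\<Sum>v\<in>vars k. (if v = w then 1 else 0) * deg k v i) =
          (\<Sum>v\<in>vars k. if v = w then deg k v i else 0)"
        by (rule sum.cong) auto
      ultimately show ?thesis
        using w by (simp add: total_deg_def d_def left_diff_distrib sum_subtractf)
    qed
    then have "total_deg k d = (\<lambda>_. 0)" by blast
    then have one: "(\<Prod>v\<in>vars k. (r v / p v) powi d v) = 1"
    proof (intro binomial_imp_power_int[OF bin])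
      fix v assume "v \<in> vars k" "d v \<noteq> 0"
      then show "p v \<noteq> 0 \<and> r v \<noteq> 0"
        using e0 False rw supp by (auto simp: d_def split: if_splits)
    qed
    have "character k s (deg k w) = (\<Prod>j=1..k+1. (\<Prod>v\<in>vars k. (r v / p v) powi c j v) powi deg k w j)"
      unfolding character_def s_def by (rule prod.cong) auto
    also have "\<dots> = (\<Prod>v\<in>vars k. \<Prod>j=1..k+1. (r v / p v) powi (c j v * deg k w j))"
      unfolding prod_power_int power_int_mult by (rule prod.swap)
    also have "\<dots> = (\<Prod>v\<in>vars k. (r v / p v) powi d v * (if v = w then r v / p v else 1))"
    proof (rule prod.cong[OF refl])
      fix v assume v: "v \<in> vars k"
      show "(\<Prod>j=1..k+1. (r v / p v) powi (c j v * deg k w j)) =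
              (r v / p v) powi d v * (if v = w then r v / p v else 1)"
      proof (cases "p v = 0")
        case True
        then have "v \<noteq> w" using False by auto
        then have "d v = 0" using e0[OF v True] by (simp add: d_def)
        then show ?thesis using c(1) True v \<open>v \<noteq> w\<close> by simp
      next
        case False
        then have "r v / p v \<noteq> 0" using supp[OF v] by simp
        then have "(\<Prod>j=1..k+1. (r v / p v) powi (c j v * deg k w j)) = (r v / p v) powi e v"
          unfolding e_def by (rule power_int_sum[symmetric])
        also have "e v = d v + (if v = w then 1 else 0)" by (simp add: d_def)
        finally show ?thesis using \<open>r v / p v \<noteq> 0\<close> by (simp add: power_int_add)
      qed
    qed
    also have "\<dots> = r w / p w" unfolding prod.distrib one using w by simp
    finally show ?thesis using False by simp
  qed
  then have "torus_act k s p = r"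
    using r by (auto simp: torus_act_def character_def aff_def PiE_def extensional_def fun_eq_iff)
  with s show ?thesis by blast
qed

text \<open>The hypotheses say that \<open>\<theta>\<close> lies in the relative interior of the cone spanned by the degrees
  of the variables not vanishing at \<open>p\<close>, and that these degrees generate the whole lattice.\<close>

lemma stableI:
  assumes n: "n = 2 * k + 1" and p: "p \<in> spec_cox n k"
    and m: "m \<ge> 1" "total_deg k (\<lambda>v. int (a v)) = (\<lambda>j. int m * \<theta> j)"
    and a: "\<And>v. v \<in> vars k \<Longrightarrow> a v > 0 \<longleftrightarrow> p v \<noteq> 0"
    and gen: "\<And>j. j \<in> {1..k+1} \<Longrightarrow> \<exists>c. (\<forall>v\<in>vars k. p v = 0 \<longrightarrow> c v = 0) \<and>
           total_deg k c = (\<lambda>i. if i = j then 1 else 0)"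
  shows "p \<in> stable n k \<theta>"
proof -
  \<comment> \<open>\<open>\<F>\<close> consists of the polynomials vanishing on the orbit, and
    \<open>C\<close> is the Zariski closure of the orbit. What has to be shown is that
    \<open>C\<close> contains no further semistable points.\<close>
  define \<F> where "\<F> = {F\<in>polys k. \<forall>s\<in>torus k. peval F (torus_act k s p) = 0}"
  define C where "C = {r\<in>aff k. \<forall>F\<in>\<F>. peval F r = 0}"
  have pa: "monomial_value k a p \<noteq> 0" using a by (simp add: monomial_value_nonzero)
  have orbit_ss: "torus_act k s p \<in> semistable n k \<theta>" if s: "s \<in> torus k" for s
    unfolding semistable_iff
    using spec_cox_torus_act[OF n p s] m pa monomial_value_torus_act[OF s, of a p] character_nonzero[OF s]
    by (metis mult_eq_0_iff)
  have "r \<in> (\<lambda>s. torus_act k s p) ` torus k" if rC: "r \<in> C" and ss: "r \<in> semistable n k \<theta>" for r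
  proof -
    \<comment> \<open>Two monomials of equal degree are scaled by the same character, so this
      binomial vanishes on the whole orbit and hence at \<open>r\<close>.\<close>
    have bin: "monomial_value k b p * monomial_value k a r = monomial_value k a p * monomial_value k b r"
      if "total_deg k (\<lambda>v. int (a v)) = total_deg k (\<lambda>v. int (b v))" for a b
    proof -
      from that have "cox_monom k a (monomial_value k b p) + cox_monom k b (- monomial_value k a p) \<in> \<F>"
        unfolding \<F>_def using monomial_value_torus_act
        by (auto intro!: polys_add simp: peval_add)
      then show ?thesis using rC by (auto simp: C_def peval_add)
    qed
    have "p v = 0 \<longleftrightarrow> r v = 0" if v: "v \<in> vars k" for v
    proof
      assume p0: "p v = 0"
      have ev: "monomial_value k ((\<lambda>_. 0)(v := 1)) q = q v" for q
      proof -
        have "monomial_value k ((\<lambda>_. 0)(v := 1)) q = (\<Prod>w\<in>vars k. if w = v then q w else 1)"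
          unfolding monomial_value_def by (rule prod.cong) auto
        then show ?thesis using v by simp
      qed
      have "cox_monom k ((\<lambda>_. 0)(v := 1)) 1 \<in> \<F>"
        unfolding \<F>_def using p0 v torus_act_eq[OF v] by (auto simp: ev simp del: fun_upd_apply One_nat_def)
      then show "r v = 0" using rC by (auto simp: C_def ev simp del: fun_upd_apply One_nat_def)
    next
      assume r0: "r v = 0"
      show "p v = 0"
      proof (rule ccontr)
        assume "p v \<noteq> 0"
        then have av: "a v > 0" using a[OF v] by simp
        \<comment> \<open>Semistability of \<open>r\<close> prevents further coordinates from
          vanishing in the limit: the \<open>l\<close>-th power of the monomial \<open>a\<close> and
          the \<open>m\<close>-th power of \<open>b\<close> have the same degree, so the binomial
          equation transfers nonvanishing from \<open>b\<close> to \<open>a\<close> at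
          \<open>r\<close>.\<close>
        obtain l b where l: "l \<ge> 1" "total_deg k (\<lambda>v. int (b v)) = (\<lambda>j. int l * \<theta> j)"
          "monomial_value k b r \<noteq> 0"
          using ss unfolding semistable_iff by blast
        have scale: "total_deg k (\<lambda>v. int (t * f v)) j = int t * total_deg k (\<lambda>v. int (f v)) j" for t f j
          by (simp add: total_deg_def sum_distrib_left mult.assoc)
        have "total_deg k (\<lambda>v. int (l * a v)) = total_deg k (\<lambda>v. int (m * b v))"
          unfolding fun_eq_iff scale m(2) l(2) by simp
        from bin[OF this]
        have "monomial_value k b p ^ m * monomial_value k a r ^ l =
              monomial_value k a p ^ l * monomial_value k b r ^ m"
          unfolding monomial_value_power .
        then have "monomial_value k a r ^ l \<noteq> 0" using pa l(3) by (metis mult_eq_0_iff power_not_zero)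
        then have "monomial_value k a r \<noteq> 0" using l(1) by (metis not_one_le_zero zero_power neq0_conv)
        then show False using av r0 v by (auto simp: monomial_value_nonzero)
      qed
    qed
    then show ?thesis
      using rC by (intro in_orbit_if_binomials[OF bin _ _ gen]) (auto simp: C_def)
  qed
  then have "(\<lambda>s. torus_act k s p) ` torus k = C \<inter> semistable n k \<theta>"
    using orbit_ss by (auto simp: C_def \<F>_def torus_act_aff)
  moreover have "zariski_closed k C"
    unfolding zariski_closed_def C_def by (rule exI[of _ \<F>]) (auto simp: \<F>_def)
  moreover have "finite {s\<in>torus k. torus_act k s p = p}"
    by (rule finite_subset[of _ "{\<lambda>j\<in>{1..k+1}. 1}"]) (use stabiliser_trivial[OF _ _ gen] in auto)
  moreover have "p \<in> semistable n k \<theta>"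
    unfolding semistable_iff using p m pa by blast
  ultimately show ?thesis unfolding stable_def by blast
qed

section \<open>Zariski irreducibility\<close>

lemma zariski_closed_hypersurface:
  "F \<in> polys k \<Longrightarrow> zariski_closed k {p\<in>aff k. peval F p = 0}"
  unfolding zariski_closed_def by (rule exI[of _ "{F}"]) auto

lemma zariski_closed_monomial: "zariski_closed k {p\<in>aff k. monomial_value k a p = 0}"
  using zariski_closed_hypersurface[of "cox_monom k a 1" k] by simp

lemma peval_curve:
  fixes g :: "'v \<Rightarrow> complex poly"
  obtains h where "\<And>t. peval F (\<lambda>v. poly (g v) t) = poly h t"
proof
  show "peval F (\<lambda>v. poly (g v) t) = poly (\<Sum>m\<in>Poly_Mapping.keys F.
          smult (Poly_Mapping.lookup F m) (\<Prod>v\<in>Poly_Mapping.keys m. g v ^ Poly_Mapping.lookup m v)) t" for t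
    by (simp add: peval_def poly_sum poly_prod poly_power)
qed

lemma peval_cong_vars:
  assumes "F \<in> polys k" "\<And>v. v \<in> vars k \<Longrightarrow> p v = q v"
  shows "peval F p = peval F q"
proof -
  have "(\<Prod>v\<in>Poly_Mapping.keys m. p v ^ Poly_Mapping.lookup m v) =
        (\<Prod>v\<in>Poly_Mapping.keys m. q v ^ Poly_Mapping.lookup m v)" if "m \<in> Poly_Mapping.keys F" for m
    by (rule prod.cong) (use assms that in \<open>auto simp: polys_def dest!: bspec\<close>)
  then show ?thesis unfolding peval_def by simp
qed

text \<open>Suppose \<open>F\<close> is nonzero at \<open>p\<close> and \<open>G\<close> at
  \<open>r\<close>, while their product vanishes on \<open>S\<close>. Along a curve joining the
  points both pull back to nonzero polynomials in one variable with product zero, which is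
  impossible.\<close>

lemma irreducible_if_curves:
  assumes "S \<noteq> {}" "S \<subseteq> aff k"
    and curve: "\<And>p r. p \<in> S \<Longrightarrow> r \<in> S \<Longrightarrow>
      \<exists>g. (\<forall>t. restrict (\<lambda>v. poly (g v) t) (vars k) \<in> S) \<and>
          (\<forall>v\<in>vars k. poly (g v) 0 = p v \<and> poly (g v) 1 = r v)"
  shows "zariski_irreducible k S"
  unfolding zariski_irreducible_def
proof (intro conjI allI impI)
  fix A B
  assume AB: "zariski_closed k A \<and> zariski_closed k B \<and> S \<subseteq> A \<union> B"
  obtain \<A> where \<A>: "\<A> \<subseteq> polys k" "A = {p\<in>aff k. \<forall>F\<in>\<A>. peval F p = 0}"
    using AB unfolding zariski_closed_def by (elim conjE exE)
  obtain \<B> where \<B>: "\<B> \<subseteq> polys k" "B = {p\<in>aff k. \<forall>F\<in>\<B>. peval F p = 0}"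
    using AB unfolding zariski_closed_def by (elim conjE exE)
  show "S \<subseteq> A \<or> S \<subseteq> B"
  proof (rule ccontr)
    assume "\<not> (S \<subseteq> A \<or> S \<subseteq> B)"
    then obtain p r where p: "p \<in> S" "p \<notin> A" and r: "r \<in> S" "r \<notin> B" by blast
    obtain F where F: "F \<in> \<A>" "F \<in> polys k" "peval F p \<noteq> 0" using p(2) subsetD[OF assms(2) p(1)] \<A> by auto
    obtain G where G: "G \<in> \<B>" "G \<in> polys k" "peval G r \<noteq> 0" using r(2) subsetD[OF assms(2) r(1)] \<B> by auto
    obtain g where g: "\<And>t. restrict (\<lambda>v. poly (g v) t) (vars k) \<in> S"
      "\<And>v. v \<in> vars k \<Longrightarrow> poly (g v) 0 = p v" "\<And>v. v \<in> vars k \<Longrightarrow> poly (g v) 1 = r v"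
      using curve[OF p(1) r(1)] by blast
    obtain f' where f': "\<And>t. peval F (\<lambda>v. poly (g v) t) = poly f' t" using peval_curve[of F g] by blast
    obtain g' where g': "\<And>t. peval G (\<lambda>v. poly (g v) t) = poly g' t" using peval_curve[of G g] by blast
    have "peval F (\<lambda>v. poly (g v) 0) = peval F p" "peval G (\<lambda>v. poly (g v) 1) = peval G r"
      by (rule peval_cong_vars[OF F(2)], simp add: g, rule peval_cong_vars[OF G(2)], simp add: g)
    then have "f' \<noteq> 0" "g' \<noteq> 0" using F(3) G(3) f' g' by auto
    moreover have "poly (f' * g') t = 0" for t
    proof -
      let ?c = "restrict (\<lambda>v. poly (g v) t) (vars k)"
      have "peval F ?c = 0 \<or> peval G ?c = 0" 
      proof -
        have "?c \<in> A \<union> B" using g(1)[of t] AB by blast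
        then show ?thesis using F(1) G(1) unfolding \<A>(2) \<B>(2) by auto
      qed
      moreover have "peval F ?c = poly f' t" "peval G ?c = poly g' t"
        unfolding f'[symmetric] g'[symmetric] by (rule peval_cong_vars[OF F(2)], simp, rule peval_cong_vars[OF G(2)], simp)
      ultimately show ?thesis by auto
    qed
    then have "f' * g' = 0" using poly_all_0_iff_0 by blast
    ultimately show False by simp
  qed
qed (use assms(1,2) in auto)

text \<open>The zero set of a product is the union of the zero sets of its factors, and an
  irreducible set lies in one of them. The factors are split off one at a time.\<close>

lemma irreducible_monomial_vanish:
  assumes "zariski_irreducible k D" "\<And>p. p \<in> D \<Longrightarrow> monomial_value k a p = 0"
  obtains v where "v \<in> vars k" "a v > 0" "\<And>p. p \<in> D \<Longrightarrow> p v = 0"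
proof -
  have D: "D \<noteq> {}" "D \<subseteq> aff k" using assms(1) by (auto simp: zariski_irreducible_def)
  have "\<exists>v\<in>A. a v > 0 \<and> (\<forall>p\<in>D. p v = 0)"
    if "finite A" "A \<subseteq> vars k" "\<forall>p\<in>D. (\<Prod>v\<in>A. p v ^ a v) = 0" for A
    using that
  proof (induction A rule: finite_induct)
    case empty
    then show ?case using D(1) by auto
  next
    case (insert w A)
    \<comment> \<open>Partial products are rewritten as monomials in all variables, whose zero sets
      are known to be closed.\<close>
    have res: "monomial_value k (\<lambda>v. if v \<in> A' then a v else 0) p = (\<Prod>v\<in>A'. p v ^ a v)"
      if "A' \<subseteq> vars k" for A' p
    proof -
      have "monomial_value k (\<lambda>v. if v \<in> A' then a v else 0) p =
              (\<Prod>v\<in>vars k. if v \<in> A' then p v ^ a v else 1)"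
        unfolding monomial_value_def by (rule prod.cong) auto
      also have "\<dots> = (\<Prod>v\<in>A'. p v ^ a v)"
        using that by (subst prod.inter_restrict[symmetric]) (auto simp: Int_absorb1)
      finally show ?thesis .
    qed
    let ?H = "\<lambda>A'. {p\<in>aff k. (\<Prod>v\<in>A'. p v ^ a v) = 0}"
    have cl: "zariski_closed k (?H A')" if "A' \<subseteq> vars k" for A'
      using zariski_closed_monomial[of k "\<lambda>v. if v \<in> A' then a v else 0"] by (simp add: res[OF that])
    have "D \<subseteq> ?H {w} \<union> ?H A"
      using insert D(2) by auto
    moreover have "zariski_closed k (?H {w})" "zariski_closed k (?H A)"
      using insert cl[of "{w}"] cl[of A] by blast+
    ultimately have "D \<subseteq> ?H {w} \<or> D \<subseteq> ?H A"
      using assms(1) unfolding zariski_irreducible_def by blast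
    then show ?case
    proof
      assume w: "D \<subseteq> ?H {w}"
      \<comment> \<open>Vanishing of the power forces \<open>a w > 0\<close>, because exponent zero
        would give one.\<close>
      then have "\<forall>p\<in>D. p w = 0 \<and> a w > 0" by (auto simp: subset_iff)
      then show ?thesis using D(1) by blast
    next
      assume "D \<subseteq> ?H A"
      then show ?thesis using insert by blast
    qed
  qed
  from this[OF finite_vars order.refl] assms(2) show ?thesis
    by (metis monomial_value_def that)
qed

text \<open>A maximal irreducible subset lies in a member of the family and therefore equals it.
  Conversely, an irreducible set above a member lies in another member, and the members are pairwise
  incomparable.\<close>

lemma irreducible_components_eqI:
  assumes "\<And>C. C \<in> \<W> \<Longrightarrow> C \<subseteq> S \<and> zariski_irreducible k C"
    and "\<And>D. D \<subseteq> S \<Longrightarrow> zariski_irreducible k D \<Longrightarrow> \<exists>C\<in>\<W>. D \<subseteq> C"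
    and "\<And>C C'. C \<in> \<W> \<Longrightarrow> C' \<in> \<W> \<Longrightarrow> C \<subseteq> C' \<Longrightarrow> C = C'"
  shows "irreducible_components k S = \<W>"
proof (intro equalityI subsetI)
  fix C assume "C \<in> irreducible_components k S"
  then have C: "C \<subseteq> S" "zariski_irreducible k C"
    "\<And>D. C \<subseteq> D \<Longrightarrow> D \<subseteq> S \<Longrightarrow> zariski_irreducible k D \<Longrightarrow> D = C"
    unfolding irreducible_components_def by blast+
  then show "C \<in> \<W>" using assms(1,2) by metis
next
  fix C assume C: "C \<in> \<W>"
  show "C \<in> irreducible_components k S"
    unfolding irreducible_components_def
  proof (intro CollectI conjI allI impI)
    fix D assume D: "C \<subseteq> D \<and> D \<subseteq> S \<and> zariski_irreducible k D"
    then obtain C' where C': "C' \<in> \<W>" "D \<subseteq> C'" using assms(2) by blast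
    then have "C = C'" using assms(3)[OF C C'(1)] D by blast
    then show "D = C" using C' D by blast
  qed (use assms(1) C in auto)
qed

section \<open>The central fibre\<close>

text \<open>These are the squarefree forms of the monomials in \<open>degree_zero_monomials\<close>:
  exponents do not affect vanishing.\<close>

definition over_origin :: "nat \<Rightarrow> (cox_var \<Rightarrow> complex) \<Rightarrow> bool" where
  "over_origin k p \<longleftrightarrow> p Z3 * (\<Prod>i=1..k. p (T i)) = 0 \<and> p Z1 * (\<Prod>i=1..k. p (T i)) = 0 \<and>
     p Z4 * p Teps = 0 \<and> p Z2 * p Teps * (\<Prod>i=1..k. p (T i)) = 0"

text \<open>In a monomial of degree zero, each of \<open>Z1\<close>, \<open>Z2\<close>,
  \<open>Z3\<close> brings all \<open>T j\<close> with it, and \<open>Teps\<close> brings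
  \<open>Z2\<close> or \<open>Z4\<close> with it. Hence every nonconstant one vanishes at
  \<open>q\<close>, and only the constant term remains.\<close>

lemma over_origin_degree_zero:
  assumes q: "over_origin k q" and F: "F \<in> homogeneous k (\<lambda>_. 0)"
  shows "peval F q = Poly_Mapping.lookup F 0"
proof -
  have "(\<Prod>v\<in>Poly_Mapping.keys m. q v ^ Poly_Mapping.lookup m v) = (if m = 0 then 1 else 0)"
    if m: "m \<in> Poly_Mapping.keys F" for m
  proof (cases "m = 0")
    case False
    let ?a = "Poly_Mapping.lookup m"
    have deg: "total_deg k (\<lambda>v. int (?a v)) = (\<lambda>_. 0)" by (rule homogeneous_key[OF F m])
    obtain w where w: "w \<in> vars k" "?a w > 0"
      using False homogeneous_key(3)[OF F m]
      by (metis all_not_in_conv in_keys_iff keys_eq_empty neq0_conv subsetD)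
    have T: "int (?a (T j)) = int j * (int (?a Z1) + int (?a Z2)) + int (?a Z3)" if "j \<in> {1..k}" for j
      using total_deg_T[OF that, of "\<lambda>v. int (?a v)"] deg by simp
    have E: "?a Z2 + ?a Z4 = 2 * ?a Teps"
      using total_deg_eps[of k "\<lambda>v. int (?a v)"] deg by simp
    have Tpos: "?a (T j) > 0" if "j \<in> {1..k}" "?a Z1 > 0 \<or> ?a Z2 > 0 \<or> ?a Z3 > 0" for j
    proof -
      have "int (?a Z1) + int (?a Z2) \<le> int j * (int (?a Z1) + int (?a Z2))"
        using that(1) by (simp add: mult_le_cancel_right1)
      then show ?thesis using T[OF that(1)] that(2) by linarith
    qed
    have "monomial_value k ?a q = 0"
    proof (rule ccontr)
      assume "monomial_value k ?a q \<noteq> 0"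
      then have nz: "q v \<noteq> 0" if "v \<in> vars k" "?a v > 0" for v
        using that by (auto simp: monomial_value_nonzero)
      have Tnz: "(\<Prod>i=1..k. q (T i)) \<noteq> 0" if "?a Z1 > 0 \<or> ?a Z2 > 0 \<or> ?a Z3 > 0"
        using nz[of "T _"] Tpos[OF _ that] by simp
      have "?a Z1 = 0" using q nz[of Z1] Tnz unfolding over_origin_def by (metis mult_eq_0_iff neq0_conv vars_mem(1))
      moreover have "?a Z3 = 0" using q nz[of Z3] Tnz unfolding over_origin_def by (metis mult_eq_0_iff neq0_conv vars_mem(3))
      moreover have "?a Teps = 0"
      proof (rule ccontr)
        assume "?a Teps \<noteq> 0"
        then have "q Teps \<noteq> 0" "?a Z2 > 0 \<or> ?a Z4 > 0" using nz[of Teps] E by auto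
        then show False
          using q nz[of Z2] nz[of Z4] Tnz unfolding over_origin_def by (metis mult_eq_0_iff vars_mem(2,4))
      qed
      ultimately have "\<forall>v\<in>vars k. ?a v = 0"
        using E T by (auto simp: ball_vars)
      then show False using w by auto
    qed
    then show ?thesis using False homogeneous_key(2)[OF F m, of q] by simp
  qed simp
  then have "peval F q = (\<Sum>m\<in>Poly_Mapping.keys F. if m = 0 then Poly_Mapping.lookup F 0 else 0)"
    unfolding peval_def by (intro sum.cong) auto
  then show ?thesis by (simp add: in_keys_iff)
qed

section \<open>Explicit invariants of the dihedral group and the equations they impose\<close>

definition monom3 :: "(3 \<Rightarrow> nat) \<Rightarrow> complex \<Rightarrow> 3 cpoly" where
  "monom3 e c = Poly_Mapping.single (Abs_poly_mapping e) c"

lemma peval_monom3: "peval (monom3 e c) p = c * (p 1 ^ e 1 * p 2 ^ e 2 * p 3 ^ e 3)"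
proof -
  have "peval (monom3 e c) p = c * (\<Prod>v\<in>UNIV. p v ^ Poly_Mapping.lookup (Abs_poly_mapping e) v)"
    unfolding monom3_def peval_single by (subst prod_keys_superset[of UNIV]) (rule finite, rule subset_UNIV, rule refl)
  also have "Poly_Mapping.lookup (Abs_poly_mapping e) = e" by (rule lookup_Abs_poly_mapping) (rule finite)
  also have "(\<Prod>v\<in>UNIV. p v ^ e v) = p 1 ^ e 1 * p 2 ^ e 2 * p 3 ^ e 3" unfolding UNIV_3 by simp
  finally show ?thesis .
qed

lemma rho_apply:
  "(rho \<zeta> *v x) $ 1 = \<zeta> * x $ 1" "(rho \<zeta> *v x) $ 2 = inverse \<zeta> * x $ 2" "(rho \<zeta> *v x) $ 3 = x $ 3"
  by (simp_all add: rho_def matrix_vector_mult_def sum_3)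

lemma epsilon_apply:
  "(epsilon *v x) $ 1 = x $ 2" "(epsilon *v x) $ 2 = x $ 1" "(epsilon *v x) $ 3 = - x $ 3"
  by (simp_all add: epsilon_def matrix_vector_mult_def sum_3)

lemma invertible_generators:
  "\<zeta> \<noteq> 0 \<Longrightarrow> invertible (rho \<zeta>)" "invertible epsilon"
proof -
  show "invertible epsilon"
    unfolding invertible_def
    by (rule exI[of _ epsilon])
       (simp add: epsilon_def matrix_matrix_mult_def mat_def vec_eq_iff forall_3 sum_3)
  show "invertible (rho \<zeta>)" if "\<zeta> \<noteq> 0"
    unfolding invertible_def
    by (rule exI[of _ "rho (inverse \<zeta>)"])
       (use that in \<open>simp add: rho_def matrix_matrix_mult_def mat_def vec_eq_iff forall_3 sum_3\<close>)
qed

text \<open>Induction over the group. Invertibility is carried along, since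
  \<open>matrix_inv\<close> cancels only for invertible matrices.\<close>

lemma invariantsI:
  assumes "\<zeta> \<noteq> 0"
    and "\<And>x. peval f (\<lambda>c. (rho \<zeta> *v x) $ c) = peval f (\<lambda>c. x $ c)"
    and "\<And>x. peval f (\<lambda>c. (epsilon *v x) $ c) = peval f (\<lambda>c. x $ c)"
  shows "f \<in> invariants \<zeta>"
proof -
  have "invertible A \<and> (\<forall>x. peval f (\<lambda>c. (A *v x) $ c) = peval f (\<lambda>c. x $ c))"
    if "A \<in> dihedral_group \<zeta>" for A
    using that
  proof induction
    case one
    have "invertible (mat 1 :: complex^3^3)" unfolding invertible_def by (rule exI[of _ "mat 1"]) simp
    then show ?case by simp
  next
    case (mult A B)
    then show ?case by (auto simp: invertible_mult matrix_vector_mul_assoc[symmetric])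
  next
    case (inverse A)
    then have "\<exists>B. A ** B = mat 1 \<and> B ** A = mat 1" by (simp add: invertible_def)
    then have "A ** matrix_inv A = mat 1 \<and> matrix_inv A ** A = mat 1"
      unfolding matrix_inv_def by (rule someI_ex)
    then have inv: "A ** matrix_inv A = mat 1" "matrix_inv A ** A = mat 1" by blast+
    then have "invertible (matrix_inv A)" unfolding invertible_def by blast
    moreover have "peval f (\<lambda>c. (matrix_inv A *v x) $ c) = peval f (\<lambda>c. x $ c)" for x
    proof -
      have "peval f (\<lambda>c. (matrix_inv A *v x) $ c) = peval f (\<lambda>c. (A *v (matrix_inv A *v x)) $ c)"
        using inverse by simp
      then show ?thesis by (simp add: matrix_vector_mul_assoc inv)
    qed
    ultimately show ?case by blast
  qed (use assms invertible_generators in auto)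
  then show ?thesis by (auto simp: invariants_def)
qed

text \<open>Under the embedding these four monomials become the invariants xy, x^n + y^n, z^2 and
  (x^n - y^n)^2.\<close>

lemma degree_zero_monomials:
  "monomial_value k (\<lambda>v. case v of Z3 \<Rightarrow> 1 | T i \<Rightarrow> 1 | _ \<Rightarrow> 0) p = p Z3 * (\<Prod>i=1..k. p (T i))"
  "monomial_value k (\<lambda>v. case v of Z1 \<Rightarrow> 1 | T i \<Rightarrow> i | _ \<Rightarrow> 0) p = p Z1 * (\<Prod>i=1..k. p (T i) ^ i)"
  "monomial_value k (\<lambda>v. case v of Z4 \<Rightarrow> 2 | Teps \<Rightarrow> 1 | _ \<Rightarrow> 0) p = p Z4 ^ 2 * p Teps"
  "monomial_value k (\<lambda>v. case v of Z2 \<Rightarrow> 2 | Teps \<Rightarrow> 1 | T i \<Rightarrow> 2 * i | _ \<Rightarrow> 0) p =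
     p Z2 ^ 2 * p Teps * (\<Prod>i=1..k. p (T i) ^ i) ^ 2"
  by (simp_all add: monomial_value_def prod_vars prod_power_distrib power_mult[symmetric] mult.commute)

lemma degree_zero_homogeneous:
  "cox_monom k (\<lambda>v. case v of Z3 \<Rightarrow> 1 | T i \<Rightarrow> 1 | _ \<Rightarrow> 0) 1 \<in> homogeneous k (\<lambda>_. 0)"
  "cox_monom k (\<lambda>v. case v of Z1 \<Rightarrow> 1 | T i \<Rightarrow> i | _ \<Rightarrow> 0) 1 \<in> homogeneous k (\<lambda>_. 0)"
  "cox_monom k (\<lambda>v. case v of Z4 \<Rightarrow> 2 | Teps \<Rightarrow> 1 | _ \<Rightarrow> 0) 1 \<in> homogeneous k (\<lambda>_. 0)"
  "cox_monom k (\<lambda>v. case v of Z2 \<Rightarrow> 2 | Teps \<Rightarrow> 1 | T i \<Rightarrow> 2 * i | _ \<Rightarrow> 0) 1 \<in> homogeneous k (\<lambda>_. 0)"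
  by (rule cox_monom_homogeneous, rule total_deg_eqI; simp)+

lemma embedding_T_cancel:
  assumes "\<forall>j\<in>{1..k+1}. t j \<noteq> (0::complex)"
  shows "(\<Prod>i=1..k. t i ^ (n div gcd n i)) * (\<Prod>i=1..k. t i powi (- int (n div gcd n i))) = 1"
    and "(\<Prod>i=1..k. t i ^ (i * n div gcd n i)) * (\<Prod>i=1..k. (t i powi (- int (n div gcd n i))) ^ i) = 1"
proof -
  show "(\<Prod>i=1..k. t i ^ (n div gcd n i)) * (\<Prod>i=1..k. t i powi (- int (n div gcd n i))) = 1"
    unfolding prod.distrib[symmetric]
    by (rule prod.neutral) (use assms in \<open>auto simp: power_int_minus\<close>)
  have cancel: "t i ^ (i * n div gcd n i) * (t i powi (- int (n div gcd n i))) ^ i = 1"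
    if "i \<in> {1..k}" for i
  proof -
    \<comment> \<open>Exact because \<open>gcd n i\<close> divides \<open>n\<close>.\<close>
    have "i * n div gcd n i = (n div gcd n i) * i"
      by (metis div_mult_swap gcd_dvd1 mult.commute)
    then have "t i ^ (i * n div gcd n i) * (t i powi (- int (n div gcd n i))) ^ i =
        (t i ^ (n div gcd n i) * t i powi (- int (n div gcd n i))) ^ i"
      by (simp only: power_mult power_mult_distrib)
    then show ?thesis using assms that by (simp add: power_int_minus)
  qed
  show "(\<Prod>i=1..k. t i ^ (i * n div gcd n i)) * (\<Prod>i=1..k. (t i powi (- int (n div gcd n i))) ^ i) = 1"
    unfolding prod.distrib[symmetric] by (intro prod.neutral ballI cancel)
qed

lemma cox_embedding_T [simp]:
  "i \<in> {1..k} \<Longrightarrow> cox_embedding n k x t (T i) = t i powi (- int (n div gcd n i))"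
  by (simp add: cox_embedding_def)

lemma cox_embedding_simps:
  "cox_embedding n k x t Z1 = (x$1 ^ n + x$2 ^ n) * (\<Prod>i=1..k. t i ^ (i * n div gcd n i))"
  "cox_embedding n k x t Z2 = (x$1 ^ n - x$2 ^ n) * t (k + 1) * (\<Prod>i=1..k. t i ^ (i * n div gcd n i))"
  "cox_embedding n k x t Z3 = x$1 * x$2 * (\<Prod>i=1..k. t i ^ (n div gcd n i))"
  "cox_embedding n k x t Z4 = x$3 * t (k + 1)"
  "cox_embedding n k x t Teps = t (k + 1) powi (- 2)"
  by (simp_all add: cox_embedding_def)

text \<open>At points satisfying \<open>over_origin\<close>, a degree zero element takes its
  constant coefficient as value. In the other direction, the four explicit invariants vanish at the
  origin, so their monomials vanish at \<open>p\<close>.\<close>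

lemma central_fibre_iff:
  assumes n: "n > 0" and \<zeta>: "\<zeta> ^ n = 1"
  shows "p \<in> central_fibre n k \<zeta> \<longleftrightarrow> p \<in> spec_cox n k \<and> over_origin k p"
proof
  assume p: "p \<in> spec_cox n k \<and> over_origin k p"
  have "peval F p = peval f (\<lambda>c. 0)"
    if F: "F \<in> homogeneous k (\<lambda>_. 0)"
      and eq: "\<forall>x t. (\<forall>j\<in>{1..k+1}. t j \<noteq> 0) \<longrightarrow> peval F (cox_embedding n k x t) = peval f (\<lambda>c. x $ c)"
    for F f
  proof -
    \<comment> \<open>A reference point above the origin: there \<open>F\<close> has the value f(0),
      and \<open>F\<close> takes equal values at all points satisfying
      \<open>over_origin\<close>.\<close>
    let ?q = "cox_embedding n k 0 (\<lambda>_. 1)"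
    have "over_origin k ?q" using n by (simp add: over_origin_def cox_embedding_simps)
    moreover have "peval F ?q = peval f (\<lambda>c. 0)"
    proof -
      have "($) (0 :: complex^3) = (\<lambda>c. 0)" by auto
      then show ?thesis using eq[rule_format, of "\<lambda>_. 1" 0] by simp
    qed
    ultimately show ?thesis using over_origin_degree_zero[OF _ F] p by metis
  qed
  then show "p \<in> central_fibre n k \<zeta>" using p by (auto simp: central_fibre_def)
next
  assume p: "p \<in> central_fibre n k \<zeta>"
  have z0: "\<zeta> \<noteq> 0" using n \<zeta> by (auto simp: power_0_left)
  have vanish: "peval F p = 0"
    if "f \<in> invariants \<zeta>" "F \<in> homogeneous k (\<lambda>_. 0)" "peval f (\<lambda>c. 0) = 0"
      "\<And>x t. \<forall>j\<in>{1..k+1}. t j \<noteq> 0 \<Longrightarrow> peval F (cox_embedding n k x t) = peval f (\<lambda>c. x $ c)"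
    for f F
    using p that unfolding central_fibre_def by auto
  have "p Z3 * (\<Prod>i=1..k. p (T i)) = 0"
  proof -
    let ?f = "monom3 ((\<lambda>_. 0)(1 := 1, 2 := 1)) 1"
    have "?f \<in> invariants \<zeta>"
      by (rule invariantsI[OF z0]) (use z0 in \<open>simp_all add: peval_monom3 rho_apply epsilon_apply\<close>)
    from vanish[OF this degree_zero_homogeneous(1)] show ?thesis
      using embedding_T_cancel(1)
      by (simp add: peval_monom3 degree_zero_monomials cox_embedding_simps mult.assoc)
  qed
  moreover have "p Z1 * (\<Prod>i=1..k. p (T i) ^ i) = 0"
  proof -
    let ?f = "monom3 ((\<lambda>_. 0)(1 := n)) 1 + monom3 ((\<lambda>_. 0)(2 := n)) 1"
    have "?f \<in> invariants \<zeta>"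
      by (rule invariantsI[OF z0])
         (use \<zeta> in \<open>simp_all add: peval_add peval_monom3 rho_apply epsilon_apply power_mult_distrib power_inverse\<close>)
    from vanish[OF this degree_zero_homogeneous(2)] show ?thesis
      using embedding_T_cancel(2) n
      by (simp add: peval_add peval_monom3 degree_zero_monomials cox_embedding_simps mult.assoc)
  qed
  moreover have "p Z4 ^ 2 * p Teps = 0"
  proof -
    let ?f = "monom3 ((\<lambda>_. 0)(3 := 2)) 1"
    have "?f \<in> invariants \<zeta>"
      by (rule invariantsI[OF z0]) (simp_all add: peval_monom3 rho_apply epsilon_apply)
    from vanish[OF this degree_zero_homogeneous(3)] show ?thesis
      by (simp add: peval_monom3 degree_zero_monomials cox_embedding_simps power_mult_distrib power_int_minus)
  qed
  moreover have "p Z2 ^ 2 * p Teps * (\<Prod>i=1..k. p (T i) ^ i) ^ 2 = 0"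
  proof -
    \<comment> \<open>The invariant (x^n - y^n)^2, expanded into three monomials.\<close>
    let ?f = "monom3 ((\<lambda>_. 0)(1 := 2 * n)) 1 + (monom3 ((\<lambda>_. 0)(1 := n, 2 := n)) (- 2) + monom3 ((\<lambda>_. 0)(2 := 2 * n)) 1)"
    have f: "peval ?f x = (x 1 ^ n - x 2 ^ n) ^ 2" for x
      by (simp add: peval_add peval_monom3 power2_diff power_even_eq)
    have "?f \<in> invariants \<zeta>"
    proof (rule invariantsI[OF z0])
      fix x
      show "peval ?f (\<lambda>c. (rho \<zeta> *v x) $ c) = peval ?f (\<lambda>c. x $ c)"
        unfolding f rho_apply using \<zeta> by (simp add: power_mult_distrib power_inverse)
      show "peval ?f (\<lambda>c. (epsilon *v x) $ c) = peval ?f (\<lambda>c. x $ c)"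
        unfolding f epsilon_apply by (rule power2_commute)
    qed
    moreover have "peval (cox_monom k (\<lambda>v. case v of Z2 \<Rightarrow> 2 | Teps \<Rightarrow> 1 | T i \<Rightarrow> 2 * i | _ \<Rightarrow> 0) 1)
          (cox_embedding n k x t) = peval ?f (\<lambda>c. x $ c)" if t: "\<forall>j\<in>{1..k+1}. t j \<noteq> 0" for x t
    proof -
      let ?P = "\<Prod>i=1..k. t i ^ (i * n div gcd n i)"
      let ?Q = "\<Prod>i=1..k. cox_embedding n k x t (T i) ^ i"
      have PQ: "?P * ?Q = 1" using embedding_T_cancel(2)[OF t] by simp
      have tt: "t (k + 1) ^ 2 * t (k + 1) powi (- 2) = 1" using t by (simp add: power_int_minus)
      have "((x$1 ^ n - x$2 ^ n) * t (k + 1) * ?P) ^ 2 * t (k + 1) powi (- 2) * ?Q ^ 2 =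
            (x$1 ^ n - x$2 ^ n) ^ 2 * (t (k + 1) ^ 2 * t (k + 1) powi (- 2)) * (?P * ?Q) ^ 2"
        by (simp only: power_mult_distrib mult_ac)
      also have "\<dots> = (x$1 ^ n - x$2 ^ n) ^ 2" unfolding PQ tt by simp
      finally show ?thesis
        unfolding f peval_cox_monom degree_zero_monomials by (simp only: cox_embedding_simps mult_1)
    qed
    ultimately have "peval (cox_monom k (\<lambda>v. case v of Z2 \<Rightarrow> 2 | Teps \<Rightarrow> 1 | T i \<Rightarrow> 2 * i | _ \<Rightarrow> 0) 1) p = 0"
      by (intro vanish[OF _ degree_zero_homogeneous(4)]) (use n in \<open>auto simp only: f power_0_left, simp\<close>)
    then show ?thesis by (simp add: degree_zero_monomials)
  qed
  moreover have "(\<Prod>i=1..k. p (T i) ^ i) = 0 \<longleftrightarrow> (\<Prod>i=1..k. p (T i)) = 0" by auto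
  ultimately have "over_origin k p" by (auto simp: over_origin_def)
  then show "p \<in> spec_cox n k \<and> over_origin k p" using p by (simp add: central_fibre_def)
qed

section \<open>The components in coordinates and their irreducibility\<close>

lemma spec_cox_T_zero:
  assumes "n = 2 * k + 1" "j \<in> {1..k}" "p \<in> aff k" "p (T j) = 0"
  shows "p \<in> spec_cox n k \<longleftrightarrow> p Z1 ^ 2 = p Z2 ^ 2 * p Teps"
proof -
  have "(\<Prod>i=1..k. p (T i) ^ (n - 2 * i)) = 0"
    using assms by (intro prod_zero) (auto intro!: bexI[of _ j])
  then show ?thesis using assms(3) by (simp add: spec_cox_def del: prod_zero_iff)
qed

lemma W_comp_eq:
  assumes "n = 2 * k + 1" "j \<in> {1..k}"
  shows "W_comp n k j = {p\<in>aff k. p Z4 = 0 \<and> p (T j) = 0 \<and> p Z1 ^ 2 = p Z2 ^ 2 * p Teps}"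
  using spec_cox_T_zero[OF assms] by (auto simp: W_comp_def spec_cox_def)

lemma W'_comp_eq:
  assumes "n = 2 * k + 1" "j \<in> {1..k}"
  shows "W'_comp n k j = {p\<in>aff k. \<forall>v\<in>{Z1, Teps, T j}. p v = 0}"
  using spec_cox_T_zero[OF assms] by (auto simp: W'_comp_def) (auto simp: spec_cox_def)

lemma W0_comp_eq: "n > 0 \<Longrightarrow> W0_comp n k = {p\<in>aff k. \<forall>v\<in>{Z1, Z3, Teps}. p v = 0}"
  by (auto simp: W0_comp_def spec_cox_def)

lemma Wu_comp_eq: "n > 0 \<Longrightarrow> Wu_comp n k = {p\<in>aff k. \<forall>v\<in>{Z1, Z2, Z3, Z4}. p v = 0}"
  by (auto simp: Wu_comp_def spec_cox_def)

text \<open>Ones satisfy Z1^2 = Z2^2 Teps, so such points exist on each \<open>W_comp\<close> as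
  well as on coordinate subspaces. They witness nonemptiness and tell the components apart.\<close>

definition generic_point :: "nat \<Rightarrow> cox_var set \<Rightarrow> cox_var \<Rightarrow> complex" where
  "generic_point k V = (\<lambda>v\<in>vars k. if v \<in> V then 0 else 1)"

lemma generic_point_aff [simp]: "generic_point k V \<in> aff k"
  by (simp add: generic_point_def aff_def)

lemma generic_point_apply [simp]: "v \<in> vars k \<Longrightarrow> generic_point k V v = (if v \<in> V then 0 else 1)"
  by (simp add: generic_point_def)

lemma irreducible_coordinate_subspace: "zariski_irreducible k {p\<in>aff k. \<forall>v\<in>V. p v = 0}"
  if "V \<subseteq> vars k"
proof (rule irreducible_if_curves)
  show "{p\<in>aff k. \<forall>v\<in>V. p v = 0} \<noteq> {}"
    using that generic_point_aff[of k V] by (auto intro!: exI[of _ "generic_point k V"])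
  fix p r
  assume "p \<in> {p\<in>aff k. \<forall>v\<in>V. p v = 0}" "r \<in> {p\<in>aff k. \<forall>v\<in>V. p v = 0}"
  then show "\<exists>g. (\<forall>t. restrict (\<lambda>v. poly (g v) t) (vars k) \<in> {p\<in>aff k. \<forall>v\<in>V. p v = 0}) \<and>
          (\<forall>v\<in>vars k. poly (g v) 0 = p v \<and> poly (g v) 1 = r v)"
    using that by (intro exI[of _ "\<lambda>v. [:p v, r v - p v:]"]) (auto simp: aff_def restrict_def)
qed auto

text \<open>The surface \<open>Z1\<^sup>2 = Z2\<^sup>2 Teps\<close> is the image of the plane under \<open>(s, \<tau>) \<mapsto> (s \<tau>, s, \<tau>\<^sup>2)\<close>.\<close>

lemma Whitney_umbrella_param:
  assumes "x ^ 2 = y ^ 2 * (e :: complex)"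
  obtains \<tau> where "x = y * \<tau>" "e = \<tau> ^ 2"
proof (cases "y = 0")
  case True
  \<comment> \<open>If \<open>y\<close> vanishes, so does \<open>x\<close>, and only the square root
    of \<open>e\<close> matters.\<close>
  then show ?thesis using that[of "csqrt e"] assms by simp
next
  case False
  then show ?thesis using that[of "x / y"] assms by (simp add: power_divide)
qed

text \<open>By \<open>Whitney_umbrella_param\<close> the component is the image of an affine space;
  the images of straight lines join any two of its points.\<close>

lemma irreducible_W_comp:
  assumes "n = 2 * k + 1" "j \<in> {1..k}"
  shows "zariski_irreducible k (W_comp n k j)"
proof (rule irreducible_if_curves)
  note eq = W_comp_eq[OF assms]
  show "W_comp n k j \<noteq> {}"
    unfolding eq using assms(2) by (auto intro!: exI[of _ "generic_point k {Z4, T j}"])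
  show "W_comp n k j \<subseteq> aff k" unfolding eq by auto
  fix p r
  assume pr: "p \<in> W_comp n k j" "r \<in> W_comp n k j"
  obtain \<sigma> where \<sigma>: "p Z1 = p Z2 * \<sigma>" "p Teps = \<sigma> ^ 2"
    using pr(1) unfolding eq by (auto elim: Whitney_umbrella_param)
  obtain \<tau> where \<tau>: "r Z1 = r Z2 * \<tau>" "r Teps = \<tau> ^ 2"
    using pr(2) unfolding eq by (auto elim: Whitney_umbrella_param)
  let ?l = "\<lambda>v. [:p v, r v - p v:]"
  define a where "a = ?l Z2"
  define b where "b = [:\<sigma>, \<tau> - \<sigma>:]"
  let ?g = "?l(Z1 := a * b, Z2 := a, Teps := b ^ 2)"
  have "restrict (\<lambda>v. poly (?g v) t) (vars k) \<in> W_comp n k j" for t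
    using pr assms(2) unfolding eq by (auto simp: aff_def power_mult_distrib)
  moreover have "poly (?g v) 0 = p v \<and> poly (?g v) 1 = r v" for v
    using \<sigma> \<tau> by (auto simp: a_def b_def algebra_simps)
  ultimately show "\<exists>g. (\<forall>t. restrict (\<lambda>v. poly (g v) t) (vars k) \<in> W_comp n k j) \<and>
          (\<forall>v\<in>vars k. poly (g v) 0 = p v \<and> poly (g v) 1 = r v)" by blast
qed

text \<open>On an irreducible set each of the four monomial equations makes a single variable vanish
  identically. Combining the choices leaves the four types of components.\<close>

lemma central_fibre_cover:
  assumes n: "n = 2 * k + 1" and D: "zariski_irreducible k D"
    and sub: "\<And>p. p \<in> D \<Longrightarrow> p \<in> spec_cox n k \<and> over_origin k p"
  shows "(\<exists>j\<in>{1..k}. D \<subseteq> W_comp n k j) \<or> (\<exists>j\<in>{1..k}. D \<subseteq> W'_comp n k j) \<or>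
         D \<subseteq> W0_comp n k \<or> D \<subseteq> Wu_comp n k"
proof -
  define N where "N v \<longleftrightarrow> (\<forall>p\<in>D. p v = 0)" for v
  have *: "\<exists>v\<in>vars k. a v > 0 \<and> N v" if "\<And>p. p \<in> D \<Longrightarrow> monomial_value k a p = 0" for a
    using irreducible_monomial_vanish[OF D that] unfolding N_def by metis
  have o: "over_origin k p" if "p \<in> D" for p using sub that by blast
  have split: "(\<exists>v\<in>vars k. P v) \<longleftrightarrow> P Z1 \<or> P Z2 \<or> P Z3 \<or> P Z4 \<or> P Teps \<or> (\<exists>i\<in>{1..k}. P (T i))" for P
    by (auto simp: vars_def)
  have "N Z4 \<or> N Teps"
    using *[of "\<lambda>v. case v of Z4 \<Rightarrow> 1 | Teps \<Rightarrow> 1 | _ \<Rightarrow> 0"] o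
    by (auto simp: split monomial_value_def prod_vars over_origin_def)
  moreover have "N Z3 \<or> (\<exists>j\<in>{1..k}. N (T j))"
    using *[of "\<lambda>v. case v of Z3 \<Rightarrow> 1 | T i \<Rightarrow> 1 | _ \<Rightarrow> 0"] o
    by (auto simp: split monomial_value_def prod_vars over_origin_def simp del: prod_zero_iff)
  moreover have "N Z1 \<or> (\<exists>j\<in>{1..k}. N (T j))"
    using *[of "\<lambda>v. case v of Z1 \<Rightarrow> 1 | T i \<Rightarrow> 1 | _ \<Rightarrow> 0"] o
    by (auto simp: split monomial_value_def prod_vars over_origin_def simp del: prod_zero_iff)
  moreover have "N Z2 \<or> N Teps \<or> (\<exists>j\<in>{1..k}. N (T j))"
    using *[of "\<lambda>v. case v of Z2 \<Rightarrow> 1 | Teps \<Rightarrow> 1 | T i \<Rightarrow> 1 | _ \<Rightarrow> 0"] o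
    by (auto simp: split monomial_value_def prod_vars over_origin_def simp del: prod_zero_iff)
  ultimately consider j where "j \<in> {1..k}" "N (T j)" "N Z4" | j where "j \<in> {1..k}" "N (T j)" "N Teps"
    | "N Z1" "N Z3" "N Teps" | "N Z1" "N Z2" "N Z3" "N Z4"
    by metis
  then show ?thesis
  proof cases
    case (1 j)
    have "D \<subseteq> W_comp n k j"
    proof
      fix p assume p: "p \<in> D"
      then have "p \<in> spec_cox n k" "p (T j) = 0" "p Z4 = 0" using sub 1 by (auto simp: N_def)
      then show "p \<in> W_comp n k j"
        using spec_cox_T_zero[OF n 1(1), of p] by (auto simp: W_comp_def spec_cox_def)
    qed
    then show ?thesis using 1 by blast
  next
    case (2 j)
    have "D \<subseteq> W'_comp n k j"
    proof
      fix p assume p: "p \<in> D"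
      then have p: "p \<in> spec_cox n k" "p (T j) = 0" "p Teps = 0" using sub 2 by (auto simp: N_def)
      then have "p \<in> aff k" by (simp add: spec_cox_def)
      \<comment> \<open>With \<open>T j\<close> and \<open>Teps\<close> zero, the relation reduces
        to Z1^2 = 0.\<close>
      then have "p Z1 = 0" using spec_cox_T_zero[OF n 2(1)] p by fastforce
      then show "p \<in> W'_comp n k j" using p by (simp add: W'_comp_def)
    qed
    then show ?thesis using 2 by blast
  next
    case 3
    then have "D \<subseteq> W0_comp n k" using sub by (auto simp: W0_comp_def N_def)
    then show ?thesis by blast
  next
    case 4
    then have "D \<subseteq> Wu_comp n k" using sub by (auto simp: Wu_comp_def N_def)
    then show ?thesis by blast
  qed
qed

lemma irreducible_components_central_fibre:
  assumes n: "n = 2 * k + 1" and k: "k \<ge> 1" and \<zeta>: "\<zeta> ^ n = 1"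
  shows "irreducible_components k (central_fibre n k \<zeta>) =
           W_comp n k ` {1..k} \<union> W'_comp n k ` {1..k} \<union> {W0_comp n k, Wu_comp n k}"
    (is "_ = ?\<W>")
proof (rule irreducible_components_eqI)
  have n0: "n > 0" using n by simp
  note cf = central_fibre_iff[OF n0 \<zeta>]
  note eqs = W_comp_eq[OF n] W'_comp_eq[OF n] W0_comp_eq[OF n0] Wu_comp_eq[OF n0]
  fix C assume "C \<in> ?\<W>"
  then consider j where "j \<in> {1..k}" "C = W_comp n k j" | j where "j \<in> {1..k}" "C = W'_comp n k j"
    | "C = W0_comp n k" | "C = Wu_comp n k" by blast
  then show "C \<subseteq> central_fibre n k \<zeta> \<and> zariski_irreducible k C"
  proof cases
    case (1 j)
    have "over_origin k p" if "p \<in> C" for p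
      using that 1 by (auto simp: W_comp_def over_origin_def)
    then show ?thesis using 1 irreducible_W_comp[OF n] by (auto simp: cf W_comp_def)
  next
    case (2 j)
    have "over_origin k p" if "p \<in> C" for p
      using that 2 by (auto simp: W'_comp_def over_origin_def)
    then have "C \<subseteq> central_fibre n k \<zeta>" using 2 by (auto simp: cf W'_comp_def)
    moreover have "zariski_irreducible k C"
      unfolding 2(2) eqs(2)[OF 2(1)] by (rule irreducible_coordinate_subspace) (use 2 in auto)
    ultimately show ?thesis ..
  next
    case 3
    then show ?thesis
      using irreducible_coordinate_subspace[of "{Z1, Z3, Teps}" k] eqs
      by (auto simp: cf over_origin_def spec_cox_def n0)
  next
    case 4
    then show ?thesis
      using irreducible_coordinate_subspace[of "{Z1, Z2, Z3, Z4}" k] eqs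
      by (auto simp: cf over_origin_def spec_cox_def n0)
  qed
next
  fix D assume D: "D \<subseteq> central_fibre n k \<zeta>" "zariski_irreducible k D"
  have "n > 0" using n by simp
  have "p \<in> spec_cox n k \<and> over_origin k p" if "p \<in> D" for p
    using D(1) that central_fibre_iff[OF \<open>n > 0\<close> \<zeta>] by blast
  from central_fibre_cover[OF n D(2) this] show "\<exists>C\<in>?\<W>. D \<subseteq> C" by blast
next
  have n0: "n > 0" using n by simp
  note eqs = W_comp_eq[OF n] W'_comp_eq[OF n] W0_comp_eq[OF n0] Wu_comp_eq[OF n0]
  fix C C' assume CC: "C \<in> ?\<W>" "C' \<in> ?\<W>" "C \<subseteq> C'"
  have C': "(\<exists>j\<in>{1..k}. C' = W_comp n k j) \<or> (\<exists>j\<in>{1..k}. C' = W'_comp n k j) \<or>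
      C' = W0_comp n k \<or> C' = Wu_comp n k" using CC(2) by blast
  from CC(1) consider j where "j \<in> {1..k}" "C = W_comp n k j" | j where "j \<in> {1..k}" "C = W'_comp n k j"
    | "C = W0_comp n k" | "C = Wu_comp n k" by blast
  then show "C = C'"
  proof cases
    case (1 j)
    \<comment> \<open>Among the listed sets, only \<open>C\<close> itself contains the point whose
      zero coordinates are exactly those prescribed on \<open>C\<close>. The other cases are
      alike.\<close>
    then have "generic_point k {Z4, T j} \<in> C'" using CC(3) by (auto simp: eqs)
    then show ?thesis using 1 C' by (auto simp: eqs split: if_splits)
  next
    case (2 j)
    then have "generic_point k {Z1, Teps, T j} \<in> C'" using CC(3) by (auto simp: eqs)
    then show ?thesis using 2 C' by (auto simp: eqs split: if_splits)
  next
    case 3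
    then have "generic_point k {Z1, Z3, Teps} \<in> C'" using CC(3) by (auto simp: eqs)
    then show ?thesis using 3 C' by (auto simp: eqs split: if_splits)
  next
    case 4
    then have "generic_point k {Z1, Z2, Z3, Z4} \<in> C'" using CC(3) by (auto simp: eqs)
    then show ?thesis using 4 C' by (auto simp: eqs split: if_splits)
  qed
qed

section \<open>Linearisations in the interior of a chamber\<close>

text \<open>The value \<open>0\<close> at \<open>j = k + 1\<close> makes the inequalities below hold uniformly at the end of the
  range. At \<open>j = 1\<close> the coordinate \<open>0\<close> is used, which vanishes on \<open>grading_space\<close>.\<close>

definition increment :: "nat \<Rightarrow> (nat \<Rightarrow> 'a) \<Rightarrow> nat \<Rightarrow> 'a::ab_group_add" where
  "increment k x j = (if j \<le> k then x j - x (j - 1) else 0)"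

lemma increment_combination:
  "increment k (\<lambda>i. \<Sum>u\<in>S. a u * u i) j = (\<Sum>u\<in>S. a u * increment k u j)"
  for a :: "(nat \<Rightarrow> real) \<Rightarrow> real"
  by (auto simp: increment_def sum_subtractf algebra_simps)

lemma increment_v: "i \<le> k \<Longrightarrow> 1 \<le> j \<Longrightarrow> increment k (v_vec k i) j = (if j \<le> i then 1 else 0)"
  by (auto simp: increment_def v_vec_def min_def of_nat_diff)

lemma increment_q: "increment k (q_vec k) j = 0"
  by (auto simp: increment_def q_vec_def)

lemma increment_w: "i \<le> k \<Longrightarrow> 1 \<le> j \<Longrightarrow> increment k (w_vec k i) j = (if j \<le> i then 1 else 0)"
  using increment_v[of i k j] increment_q[of k j]
  by (auto simp: increment_def w_vec_def)

text \<open>All the inequalities are linear, so they are checked on generators. Both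
  \<open>v_vec k i\<close> and \<open>w_vec k i\<close> have increments one up to \<open>i\<close>
  and zero afterwards; they differ in coordinate \<open>k + 1\<close>, which is zero or one.\<close>

lemma chamber_increments:
  assumes "x \<in> chamber k l" "l \<le> k"
  shows "j \<in> {1..k} \<Longrightarrow> increment k x (j + 1) \<le> increment k x j"
    and "1 \<le> l \<Longrightarrow> x (k + 1) \<le> increment k x l"
    and "increment k x (l + 1) \<le> x (k + 1)"
proof -
  \<comment> \<open>One description for all chambers: for \<open>l = 0\<close> the lower bound
    \<open>max 1 l\<close> keeps the range of the \<open>w_vec\<close> at 1 to \<open>k\<close>, and
    \<open>q_vec\<close> joins the generators.\<close>
  obtain S where S: "x \<in> fcone S"
    "S \<subseteq> v_vec k ` {1..l} \<union> w_vec k ` {max 1 l..k} \<union> (if l = 0 then {q_vec k} else {})"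
  proof (cases "l = 0")
    case True
    then show ?thesis
      using assms by (intro that[of "insert (q_vec k) (w_vec k ` {1..k})"]) (auto simp: chamber_def)
  next
    case False
    then show ?thesis
      using assms by (intro that[of "v_vec k ` {1..l} \<union> w_vec k ` {l..k}"]) (auto simp: chamber_def)
  qed
  then obtain a where a: "\<And>u. u \<in> S \<Longrightarrow> a u \<ge> 0" and x: "x = (\<lambda>j. \<Sum>u\<in>S. a u * u j)"
    unfolding fcone_def by blast
  have gen: "(\<exists>i\<in>{1..l}. u = v_vec k i) \<or> (\<exists>i\<in>{max 1 l..k}. u = w_vec k i) \<or> (l = 0 \<and> u = q_vec k)"
    if "u \<in> S" for u
    using S(2) that by (auto split: if_splits)
  have eps: "v_vec k i (k + 1) = 0" "w_vec k i (k + 1) = 1" "q_vec k (k + 1) = 1" for i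
    by (auto simp: v_vec_def w_vec_def q_vec_def)
  show "increment k x (j + 1) \<le> increment k x j" if "j \<in> {1..k}"
    unfolding x increment_combination
    using assms(2) that
    by (intro sum_mono mult_left_mono a)
       (auto dest!: gen simp: increment_v increment_w increment_q)
  show "x (k + 1) \<le> increment k x l" if "1 \<le> l"
    unfolding x increment_combination
    using assms(2) that
    by (intro sum_mono mult_left_mono a)
       (auto dest!: gen simp: increment_v increment_w increment_q eps[simplified])
  show "increment k x (l + 1) \<le> x (k + 1)"
    unfolding x increment_combination
    using assms(2)
    by (intro sum_mono mult_left_mono a)
       (auto dest!: gen simp: increment_v increment_w increment_q eps[simplified])
qed

text \<open>The line through \<open>x\<close> in direction \<open>u\<close> is continuous
  coordinatewise, hence in the product topology, so a short step backwards stays in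
  \<open>S\<close>. This is what turns weak inequalities into strict ones.\<close>

lemma interior_perturbation:
  assumes "x \<in> (top_of_set (grading_space k)) interior_of S" "u \<in> grading_space k"
  obtains t where "t > 0" "(\<lambda>j. x j - t * u j) \<in> S"
proof -
  obtain U where U: "open U" "x \<in> U" "grading_space k \<inter> U \<subseteq> S" "x \<in> grading_space k"
    using assms(1) unfolding interior_of_def by (auto simp: openin_open)
  let ?f = "\<lambda>t j. x j - t * u j"
  have "continuous_on UNIV ?f"
    by (rule continuous_on_coordinatewise_then_product) (intro continuous_intros)
  then have "open (?f -` U)" using U(1) by (simp add: continuous_on_open_vimage)
  moreover have "0 \<in> ?f -` U" using U(2) by simp
  ultimately obtain e where e: "e > 0" "ball 0 e \<subseteq> ?f -` U"
    by (meson open_contains_ball)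
  have "e / 2 \<in> ball 0 e" using e(1) by simp
  then have "?f (e / 2) \<in> U" using e(2) by (metis subsetD vimageD)
  moreover have "?f (e / 2) \<in> grading_space k"
    using U(4) assms(2) by (auto simp: grading_space_def)
  ultimately show ?thesis using that[of "e / 2"] e(1) U(3) by auto
qed

lemma linearisation_increments:
  assumes "\<theta> \<in> linearisations k l" "l \<le> k"
  shows "j \<notin> {1..k+1} \<Longrightarrow> \<theta> j = 0"
    and "j \<in> {1..k} \<Longrightarrow> increment k \<theta> (j + 1) < increment k \<theta> j"
    and "1 \<le> l \<Longrightarrow> \<theta> (k + 1) < increment k \<theta> l"
    and "increment k \<theta> (l + 1) < \<theta> (k + 1)"
proof -
  let ?x = "\<lambda>j. real_of_int (\<theta> j)"
  have int: "?x \<in> (top_of_set (grading_space k)) interior_of (chamber k l)"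
    using assms(1) by (simp add: linearisations_def)
  then have "?x \<in> grading_space k"
    using interior_of_subset_topspace by fastforce
  then show "j \<notin> {1..k+1} \<Longrightarrow> \<theta> j = 0"
    by (auto simp: grading_space_def)
  \<comment> \<open>A direction satisfying all chamber inequalities strictly: its increments are the
    even numbers 2 (k + 1 - j), and its last coordinate is the odd number between those at
    \<open>l\<close> and \<open>l + 1\<close>. Since \<open>x - t u\<close> satisfies the weak
    inequalities, \<theta> satisfies the strict ones.\<close>
  define u :: "nat \<Rightarrow> real" where
    "u = (\<lambda>j. if j \<le> k then real j * (2 * real k + 1 - real j) else if j = k + 1 then 2 * (real k - real l) + 1 else 0)"
  have "u \<in> grading_space k" by (auto simp: u_def grading_space_def)
  from interior_perturbation[OF int this]
  obtain t where t: "t > 0" "(\<lambda>j. ?x j - t * u j) \<in> chamber k l" by blast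
  have inc_u: "increment k u j = 2 * (real k + 1 - real j)" if "j \<in> {1..k+1}" for j
    using that by (auto simp: increment_def u_def of_nat_diff algebra_simps)
  have inc: "increment k (\<lambda>j. ?x j - t * u j) j = real_of_int (increment k \<theta> j) - t * increment k u j" for j
    by (auto simp: increment_def algebra_simps)
  note ch = chamber_increments[OF t(2) assms(2), unfolded inc]
  show "increment k \<theta> (j + 1) < increment k \<theta> j" if j: "j \<in> {1..k}"
  proof -
    have "t * increment k u (j + 1) < t * increment k u j"
      by (subst (1 2) inc_u) (use j t in auto)
    then have "real_of_int (increment k \<theta> (j + 1)) < real_of_int (increment k \<theta> j)"
      using ch(1)[OF j] by linarith
    then show ?thesis by linarith
  qed
  have uk: "u (k + 1) = 2 * (real k - real l) + 1" by (simp add: u_def)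
  show "\<theta> (k + 1) < increment k \<theta> l" if l: "1 \<le> l"
  proof -
    have "t * u (k + 1) < t * increment k u l"
      unfolding uk by (subst inc_u) (use l assms(2) t in auto)
    then have "real_of_int (\<theta> (k + 1)) < real_of_int (increment k \<theta> l)"
      using ch(2)[OF l] by linarith
    then show ?thesis by linarith
  qed
  show "increment k \<theta> (l + 1) < \<theta> (k + 1)"
  proof -
    have "t * increment k u (l + 1) < t * u (k + 1)"
      unfolding uk by (subst inc_u) (use assms(2) t in auto)
    then have "real_of_int (increment k \<theta> (l + 1)) < real_of_int (\<theta> (k + 1))"
      using ch(3) by linarith
    then show ?thesis by linarith
  qed
qed

section \<open>Concavity of a character from the interior of a fixed chamber\<close>

locale chamber_character =
  fixes k l :: nat and \<theta> :: "nat \<Rightarrow> int"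
  assumes \<theta>: "\<theta> \<in> linearisations k l" and l: "l \<le> k"
begin

abbreviation "D \<equiv> increment k \<theta>"

lemmas outside = linearisation_increments(1)[OF \<theta> l]
lemmas D_Suc = linearisation_increments(2)[OF \<theta> l]
lemmas eps_less = linearisation_increments(3)[OF \<theta> l]
lemmas eps_greater = linearisation_increments(4)[OF \<theta> l]

lemma D_antimono: "i \<le> j \<Longrightarrow> 1 \<le> i \<Longrightarrow> j \<le> k + 1 \<Longrightarrow> D j \<le> D i"
proof (induction j rule: dec_induct)
  case (step j)
  then show ?case using D_Suc[of j] by auto
qed simp

lemma D_nonneg: "1 \<le> i \<Longrightarrow> i \<le> k + 1 \<Longrightarrow> D i \<ge> 0"
  using D_antimono[of i "k + 1"] by (simp add: increment_def)

lemma eps_pos: "\<theta> (k + 1) > 0"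
  using eps_greater D_nonneg[of "l + 1"] l by simp

text \<open>The difference telescopes into the increments from \<open>i + 1\<close> to
  \<open>j\<close>, none of which exceeds the first.\<close>

lemma theta_upper: "i \<le> j \<Longrightarrow> j \<le> k \<Longrightarrow> \<theta> j - \<theta> i \<le> int (j - i) * D (i + 1)"
proof (induction j rule: dec_induct)
  case (step j)
  have "D (j + 1) \<le> D (i + 1)" using step by (intro D_antimono) auto
  moreover have "D (j + 1) = \<theta> (j + 1) - \<theta> j" using step by (simp add: increment_def)
  ultimately show ?case using step by (simp add: Suc_diff_le algebra_simps)
qed simp

text \<open>Here the telescoping increments run from \<open>j + 1\<close> to \<open>i\<close>, and
  the last one is the smallest.\<close>

lemma theta_lower: "j \<le> i \<Longrightarrow> 1 \<le> i \<Longrightarrow> i \<le> k \<Longrightarrow> int (i - j) * D i \<le> \<theta> i - \<theta> j"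
proof (induction j rule: inc_induct)
  case (step j)
  have "D i \<le> D (j + 1)" using step by (intro D_antimono) auto
  moreover have "D (j + 1) = \<theta> (j + 1) - \<theta> j" using step by (simp add: increment_def)
  moreover have "int (i - j) = int (i - Suc j) + 1" using step by simp
  ultimately show ?case using step by (simp add: algebra_simps)
qed simp

end

section \<open>Stability of the components\<close>

text \<open>Remove from \<open>C\<close> the zero set of the product of all variables outside
  \<open>V\<close>. At the remaining points exactly the variables in \<open>V\<close> vanish, so one
  exponent vector \<open>a\<close> serves them all in \<open>stableI\<close>.\<close>

lemma generically_stableI:
  assumes n: "n = 2 * k + 1" and C: "C \<subseteq> spec_cox n k" "\<And>p v. p \<in> C \<Longrightarrow> v \<in> V \<Longrightarrow> p v = 0"
    and pt: "generic_point k V \<in> C"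
    and m: "m \<ge> 1" "total_deg k (\<lambda>v. int (a v)) = (\<lambda>j. int m * \<theta> j)"
    and a: "\<And>v. v \<in> vars k \<Longrightarrow> a v > 0 \<longleftrightarrow> v \<notin> V"
    and gen: "\<And>j. j \<in> {1..k+1} \<Longrightarrow> \<exists>c. (\<forall>v\<in>V. c v = 0) \<and>
           total_deg k c = (\<lambda>i. if i = j then 1 else 0)"
  shows "generically_stable n k \<theta> C"
proof -
  let ?a = "\<lambda>v. if v \<in> V then 0 else 1"
  let ?B = "{p\<in>aff k. monomial_value k ?a p = 0}"
  have "zariski_closed k ?B" by (rule zariski_closed_monomial)
  moreover have "monomial_value k ?a (generic_point k V) \<noteq> 0"
    by (auto simp: monomial_value_nonzero)
  then have "C - ?B \<noteq> {}" using pt by blast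
  moreover have "C - ?B \<subseteq> stable n k \<theta>"
  proof
    fix p assume p: "p \<in> C - ?B"
    then have spec: "p \<in> spec_cox n k" using C(1) by blast
    then have "monomial_value k ?a p \<noteq> 0" using p by (auto simp: spec_cox_def)
    then have supp: "p v \<noteq> 0 \<longleftrightarrow> v \<notin> V" if "v \<in> vars k" for v
      using that p C(2) by (fastforce simp: monomial_value_nonzero split: if_splits)
    show "p \<in> stable n k \<theta>"
    proof (rule stableI[OF n spec m])
      show "0 < a v \<longleftrightarrow> p v \<noteq> 0" if "v \<in> vars k" for v using a supp that by metis
      show "\<exists>c. (\<forall>v\<in>vars k. p v = 0 \<longrightarrow> c v = 0) \<and> total_deg k c = (\<lambda>i. if i = j then 1 else 0)"
        if "j \<in> {1..k+1}" for j
        using gen[OF that] supp by metis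
    qed
  qed
  ultimately show ?thesis unfolding generically_stable_def by blast
qed

text \<open>A generically stable set has a semistable point. A monomial that is nonzero there
  involves no variable from \<open>V\<close>, so an obstruction on degrees suffices.\<close>

lemma not_generically_stableI:
  assumes "V \<subseteq> vars k" "\<And>p v. p \<in> C \<Longrightarrow> v \<in> V \<Longrightarrow> p v = 0"
    and "\<And>m a. m \<ge> 1 \<Longrightarrow> (\<forall>v\<in>V. a v = 0) \<Longrightarrow>
           total_deg k (\<lambda>v. int (a v)) = (\<lambda>j. int m * \<theta> j) \<Longrightarrow> False"
  shows "\<not> generically_stable n k \<theta> C"
proof
  assume "generically_stable n k \<theta> C"
  then obtain p where p: "p \<in> C" "p \<in> semistable n k \<theta>"
    unfolding generically_stable_def stable_def by blast
  then obtain m a where m: "m \<ge> 1" "total_deg k (\<lambda>v. int (a v)) = (\<lambda>j. int m * \<theta> j)"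
    and nz: "monomial_value k a p \<noteq> 0"
    unfolding semistable_iff by blast
  have "a v = 0" if "v \<in> V" for v
    using nz assms(1,2) p(1) that unfolding monomial_value_nonzero by blast
  then show False using assms(3) m by blast
qed

context chamber_character
begin

text \<open>\<open>\<theta>\<close> is strictly concave on \<open>{0..k}\<close>, so a line of slope \<open>A / K\<close> between the two
  neighbouring increments at \<open>i\<close> touches its graph at \<open>i\<close> only.\<close>

lemma supporting_line:
  assumes i: "i \<in> {1..k}" and K: "K \<ge> 0" and A: "K * D (i + 1) < A" "A < K * D i"
    and j: "j \<le> k" "j \<noteq> i"
  shows "K * \<theta> j - int j * A < K * \<theta> i - int i * A"
proof (cases "j < i")
  case True
  have "int (i - j) * A < int (i - j) * (K * D i)"
    using A(2) True by (intro mult_strict_left_mono) auto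
  also have "\<dots> = K * (int (i - j) * D i)" by simp
  also have "\<dots> \<le> K * (\<theta> i - \<theta> j)"
    using theta_lower[of j i] i True K by (intro mult_left_mono) auto
  finally show ?thesis using True by (simp add: of_nat_diff algebra_simps)
next
  case False
  then have ij: "i < j" using j by simp
  have "K * (\<theta> j - \<theta> i) \<le> K * (int (j - i) * D (i + 1))"
    using theta_upper[of i j] ij j K by (intro mult_left_mono) auto
  also have "\<dots> = int (j - i) * (K * D (i + 1))" by simp
  also have "\<dots> < int (j - i) * A"
    using A(1) ij by (intro mult_strict_left_mono) auto
  finally show ?thesis using ij by (simp add: of_nat_diff algebra_simps)
qed

lemma theta_0: "\<theta> 0 = 0"
  using outside[of 0] by simp

lemma D_le_k: "j \<in> {1..k} \<Longrightarrow> D j = \<theta> j - \<theta> (j - 1)"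
  by (simp add: increment_def)

lemma W'_generically_stable:
  assumes n: "n = 2 * k + 1" and i: "i \<in> {1..k}" "l \<le> i"
  shows "generically_stable n k \<theta> (W'_comp n k i)"
proof -
  let ?V = "{Z1, Teps, T i}"
  \<comment> \<open>The slope A / 2 is \<open>D (i + 1)\<close> plus one half, which by integrality
    lies strictly below \<open>D i\<close> and below \<open>\<theta> (k + 1)\<close>. In
    \<open>a\<close>, the slope goes to \<open>Z2\<close>, the intercept to \<open>Z3\<close>, the
    gap between line and graph at \<open>j\<close> to \<open>T j\<close>, and \<open>Z4\<close>
    fills the last coordinate.\<close>
  define A where "A = 2 * D (i + 1) + 1"
  define a where "a = (\<lambda>v. case v of Z2 \<Rightarrow> nat A | Z3 \<Rightarrow> nat (2 * \<theta> i - int i * A)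
    | Z4 \<Rightarrow> nat (2 * \<theta> (k + 1) - A)
    | T j \<Rightarrow> if j = i then 0 else nat ((2 * \<theta> i - int i * A) - (2 * \<theta> j - int j * A)) | _ \<Rightarrow> 0)"
  have A: "2 * D (i + 1) < A" "A < 2 * D i" using D_Suc[OF i(1)] by (auto simp: A_def)
  have "D (i + 1) < \<theta> (k + 1)"
    using eps_greater D_antimono[of "l + 1" "i + 1"] i by auto
  then have A': "A > 0" "A < 2 * \<theta> (k + 1)"
    using D_nonneg[of "i + 1"] i by (auto simp: A_def)
  note line = supporting_line[OF i(1) _ A, simplified]
  have pos: "2 * \<theta> i - int i * A > 0" using line[of 0] i theta_0 by simp
  show ?thesis
  proof (rule generically_stableI[OF n, where V = ?V and m = 2 and a = a])
    show "generic_point k ?V \<in> W'_comp n k i" using i by (simp add: W'_comp_eq[OF n])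
    show "total_deg k (\<lambda>v. int (a v)) = (\<lambda>j. int 2 * \<theta> j)"
    proof (rule total_deg_eqI)
      fix j assume j: "j \<in> {1..k}"
      show "int 2 * \<theta> j = int j * (int (a Z1) + int (a Z2)) + int (a Z3) - int (a (T j))"
        using line[of j] j A' pos by (cases "j = i") (auto simp: a_def)
    qed (use A' outside in \<open>auto simp: a_def\<close>)
    show "0 < a v \<longleftrightarrow> v \<notin> ?V" if "v \<in> vars k" for v
      using that line A' pos by (cases v) (auto simp: a_def)
    fix j assume j: "j \<in> {1..k+1}"
    define c :: "cox_var \<Rightarrow> int" where
      "c = (if j = k + 1 then (\<lambda>_. 0)(Z4 := 1)
            else if j = i then (\<lambda>v. case v of Z3 \<Rightarrow> 1 | T m \<Rightarrow> if m = i then 0 else 1 | _ \<Rightarrow> 0)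
            else (\<lambda>_. 0)(T j := - 1))"
    have "total_deg k c = (\<lambda>i. if i = j then 1 else 0)"
      by (rule total_deg_eqI) (use i j in \<open>auto simp: c_def\<close>)
    moreover have "\<forall>v\<in>?V. c v = 0" using i by (auto simp: c_def)
    ultimately show "\<exists>c. (\<forall>v\<in>?V. c v = 0) \<and> total_deg k c = (\<lambda>i. if i = j then 1 else 0)" by blast
  qed (auto simp: W'_comp_def)
qed

text \<open>Without \<open>T i\<close> there is equality in coordinate \<open>i\<close>. Comparison
  with coordinate \<open>i + 1\<close> bounds \<open>m * D (i + 1)\<close> by the exponent of
  \<open>Z2\<close>, hence by \<open>m * \<theta> (k + 1)\<close>, although \<open>i < l\<close>
  makes \<open>D (i + 1)\<close> larger than \<open>\<theta> (k + 1)\<close>.\<close>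

lemma W'_not_generically_stable:
  assumes i: "i \<in> {1..k}" "i < l"
  shows "\<not> generically_stable n k \<theta> (W'_comp n k i)"
proof (rule not_generically_stableI[where V = "{Z1, Teps, T i}"])
  fix m :: nat and a :: "cox_var \<Rightarrow> nat"
  assume m: "m \<ge> 1" and a: "\<forall>v\<in>{Z1, Teps, T i}. a v = 0"
    and eq: "total_deg k (\<lambda>v. int (a v)) = (\<lambda>j. int m * \<theta> j)"
  have "int m * \<theta> i = int i * int (a Z2) + int (a Z3)"
    using total_deg_T[of i k "\<lambda>v. int (a v)"] eq a i by simp
  moreover have "int m * \<theta> (i + 1) \<le> int (i + 1) * int (a Z2) + int (a Z3)"
    using total_deg_T[of "i + 1" k "\<lambda>v. int (a v)"] eq a i l by simp
  moreover have "int m * \<theta> (k + 1) \<ge> int (a Z2)"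
    using total_deg_eps[of k "\<lambda>v. int (a v)"] eq a by simp
  moreover have "int m * D (i + 1) = int m * \<theta> (i + 1) - int m * \<theta> i"
    using i l by (simp add: D_le_k right_diff_distrib)
  ultimately have "int m * D (i + 1) \<le> int m * \<theta> (k + 1)" by (simp add: algebra_simps)
  moreover have "\<theta> (k + 1) < D (i + 1)" using eps_less D_antimono[of "i + 1" l] i l by simp
  ultimately show False using m by simp
qed (use i in \<open>auto simp: W'_comp_def\<close>)

lemma W_generically_stable:
  assumes n: "n = 2 * k + 1" and i: "i \<in> {1..k}" "i \<le> l"
  shows "generically_stable n k \<theta> (W_comp n k i)"
proof -
  let ?V = "{Z4, T i}"
  \<comment> \<open>With \<open>Teps\<close> to the first power and no \<open>Z4\<close>, coordinate
    \<open>k + 1\<close> forces the exponent \<open>4 * \<theta> (k + 1) + 2\<close> of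
    \<open>Z2\<close>. The slope A / 4 has to exceed it by at least one, to leave a positive
    exponent for \<open>Z1\<close>, and stay below \<open>D i\<close>; scaling by 4 makes room for
    both.\<close>
  define A where "A = 4 * max (\<theta> (k + 1)) (D (i + 1)) + 3"
  define a where "a = (\<lambda>v. case v of Z2 \<Rightarrow> nat (4 * \<theta> (k + 1) + 2) | Z1 \<Rightarrow> nat (A - (4 * \<theta> (k + 1) + 2))
    | Z3 \<Rightarrow> nat (4 * \<theta> i - int i * A) | Teps \<Rightarrow> 1
    | T j \<Rightarrow> if j = i then 0 else nat ((4 * \<theta> i - int i * A) - (4 * \<theta> j - int j * A)) | _ \<Rightarrow> 0)"
  have "\<theta> (k + 1) < D i" using eps_less D_antimono[of i l] i l by simp
  then have A: "4 * D (i + 1) < A" "A < 4 * D i" using D_Suc[OF i(1)] by (auto simp: A_def)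
  have A': "A > 4 * \<theta> (k + 1) + 2" by (simp add: A_def)
  note line = supporting_line[OF i(1) _ A, simplified]
  have pos: "4 * \<theta> i - int i * A > 0" using line[of 0] i theta_0 by simp
  show ?thesis
  proof (rule generically_stableI[OF n, where V = ?V and m = 4 and a = a])
    show "generic_point k ?V \<in> W_comp n k i" using i by (simp add: W_comp_eq[OF n])
    show "total_deg k (\<lambda>v. int (a v)) = (\<lambda>j. int 4 * \<theta> j)"
    proof (rule total_deg_eqI)
      fix j assume j: "j \<in> {1..k}"
      show "int 4 * \<theta> j = int j * (int (a Z1) + int (a Z2)) + int (a Z3) - int (a (T j))"
        using line[of j] j A' pos eps_pos by (cases "j = i") (auto simp: a_def)
    qed (use A' eps_pos outside in \<open>auto simp: a_def\<close>)
    show "0 < a v \<longleftrightarrow> v \<notin> ?V" if "v \<in> vars k" for v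
      using that line A' pos eps_pos by (cases v) (auto simp: a_def)
    fix j assume j: "j \<in> {1..k+1}"
    \<comment> \<open>Since \<open>Z4\<close> vanishes here, the last unit vector is the degree of
      \<open>Z2\<close> minus that of \<open>Z1\<close>.\<close>
    define c :: "cox_var \<Rightarrow> int" where
      "c = (if j = k + 1 then (\<lambda>_. 0)(Z2 := 1, Z1 := - 1)
            else if j = i then (\<lambda>v. case v of Z3 \<Rightarrow> 1 | T m \<Rightarrow> if m = i then 0 else 1 | _ \<Rightarrow> 0)
            else (\<lambda>_. 0)(T j := - 1))"
    have "total_deg k c = (\<lambda>i. if i = j then 1 else 0)"
      by (rule total_deg_eqI) (use i j in \<open>auto simp: c_def\<close>)
    moreover have "\<forall>v\<in>?V. c v = 0" using i by (auto simp: c_def)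
    ultimately show "\<exists>c. (\<forall>v\<in>?V. c v = 0) \<and> total_deg k c = (\<lambda>i. if i = j then 1 else 0)" by blast
  qed (auto simp: W_comp_def)
qed

text \<open>Equality in coordinate \<open>i\<close>, compared with coordinate \<open>i - 1\<close>,
  shows that \<open>m * D i\<close> is at least the exponent of \<open>Z2\<close>. Without
  \<open>Z4\<close> that exponent is at least \<open>m * \<theta> (k + 1)\<close>, although
  \<open>l < i\<close> makes \<open>D i\<close> smaller than
  \<open>\<theta> (k + 1)\<close>.\<close>

lemma W_not_generically_stable:
  assumes i: "i \<in> {1..k}" "l < i"
  shows "\<not> generically_stable n k \<theta> (W_comp n k i)"
proof (rule not_generically_stableI[where V = "{Z4, T i}"])
  fix m :: nat and a :: "cox_var \<Rightarrow> nat"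
  assume m: "m \<ge> 1" and a: "\<forall>v\<in>{Z4, T i}. a v = 0"
    and eq: "total_deg k (\<lambda>v. int (a v)) = (\<lambda>j. int m * \<theta> j)"
  have "int m * \<theta> i = int i * (int (a Z1) + int (a Z2)) + int (a Z3)"
    using total_deg_T[of i k "\<lambda>v. int (a v)"] eq a i by simp
  moreover have "int m * \<theta> (i - 1) \<le> int (i - 1) * (int (a Z1) + int (a Z2)) + int (a Z3)"
  \<comment> \<open>For \<open>i = 1\<close> there is no preceding \<open>T\<close> variable;
    coordinate 0 of \<theta> is zero instead.\<close>
  proof (cases "i = 1")
    case False
    then have "i - 1 \<in> {1..k}" using i by auto
    from total_deg_T[OF this, of "\<lambda>v. int (a v)"] show ?thesis using eq by simp
  qed (simp add: theta_0)
  moreover have "int (i - 1) = int i - 1" using i by simp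
  moreover have "int m * \<theta> (k + 1) \<le> int (a Z2)"
    using total_deg_eps[of k "\<lambda>v. int (a v)"] eq a by simp
  moreover have "int m * D i = int m * \<theta> i - int m * \<theta> (i - 1)"
    using D_le_k[OF i(1)] by (simp add: right_diff_distrib)
  ultimately have "int m * \<theta> (k + 1) \<le> int m * D i" by (simp add: algebra_simps)
  moreover have "D i < \<theta> (k + 1)" using eps_greater D_antimono[of "l + 1" i] i by simp
  ultimately show False using m by simp
qed (use i in \<open>auto simp: W_comp_def\<close>)

lemma W0_generically_stable:
  assumes n: "n = 2 * k + 1" and l: "l = 0"
  shows "generically_stable n k \<theta> (W0_comp n k)"
proof -
  let ?V = "{Z1, Z3, Teps}"
  \<comment> \<open>Without \<open>Z3\<close> the line passes through the origin. The slope
    \<open>D 1\<close> plus one half puts it strictly above the graph, and \<open>l = 0\<close>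
    keeps it below \<open>\<theta> (k + 1)\<close>.\<close>
  define A where "A = 2 * D 1 + 1"
  define a where "a = (\<lambda>v. case v of Z2 \<Rightarrow> nat A | Z4 \<Rightarrow> nat (2 * \<theta> (k + 1) - A)
    | T j \<Rightarrow> nat (int j * A - 2 * \<theta> j) | _ \<Rightarrow> 0)"
  have A: "A > 0" "A < 2 * \<theta> (k + 1)"
    using eps_greater l D_nonneg[of 1] by (auto simp: A_def)
  have pos: "2 * \<theta> j < int j * A" if "j \<in> {1..k}" for j
    using theta_upper[of 0 j] that theta_0 by (simp add: A_def algebra_simps)
  show ?thesis
  proof (rule generically_stableI[OF n, where V = ?V and m = 2 and a = a])
    show "generic_point k ?V \<in> W0_comp n k" using n by (simp add: W0_comp_eq)
    show "total_deg k (\<lambda>v. int (a v)) = (\<lambda>j. int 2 * \<theta> j)"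
      by (rule total_deg_eqI) (use A pos outside in \<open>auto simp: a_def less_imp_le\<close>)
    show "0 < a v \<longleftrightarrow> v \<notin> ?V" if "v \<in> vars k" for v
      using that A pos by (cases v) (auto simp: a_def)
    fix j assume j: "j \<in> {1..k+1}"
    define c :: "cox_var \<Rightarrow> int" where
      "c = (if j = k + 1 then (\<lambda>_. 0)(Z4 := 1) else (\<lambda>_. 0)(T j := - 1))"
    have "total_deg k c = (\<lambda>i. if i = j then 1 else 0)"
      by (rule total_deg_eqI) (use j in \<open>auto simp: c_def\<close>)
    moreover have "\<forall>v\<in>?V. c v = 0" by (auto simp: c_def)
    ultimately show "\<exists>c. (\<forall>v\<in>?V. c v = 0) \<and> total_deg k c = (\<lambda>i. if i = j then 1 else 0)" by blast
  qed (auto simp: W0_comp_def)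
qed

text \<open>The first coordinate bounds \<open>m * \<theta> 1\<close> by the exponent of
  \<open>Z2\<close>, hence by \<open>m * \<theta> (k + 1)\<close>; but for \<open>l \<ge> 1\<close>
  the increment at 1, which is \<open>\<theta> 1\<close>, is larger than
  \<open>\<theta> (k + 1)\<close>.\<close>

lemma W0_not_generically_stable:
  assumes "l \<ge> 1"
  shows "\<not> generically_stable n k \<theta> (W0_comp n k)"
proof (rule not_generically_stableI[where V = "{Z1, Z3, Teps}"])
  fix m :: nat and a :: "cox_var \<Rightarrow> nat"
  assume m: "m \<ge> 1" and a: "\<forall>v\<in>{Z1, Z3, Teps}. a v = 0"
    and eq: "total_deg k (\<lambda>v. int (a v)) = (\<lambda>j. int m * \<theta> j)"
  have "int m * \<theta> 1 \<le> int (a Z2)"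
    using total_deg_T[of 1 k "\<lambda>v. int (a v)"] eq a assms l by simp
  moreover have "int (a Z2) \<le> int m * \<theta> (k + 1)"
    using total_deg_eps[of k "\<lambda>v. int (a v)"] eq a by simp
  ultimately have "int m * \<theta> 1 \<le> int m * \<theta> (k + 1)" by linarith
  moreover have "\<theta> (k + 1) < \<theta> 1"
    using eps_less[OF assms] D_antimono[of 1 l] D_le_k[of 1] theta_0 assms l by simp
  ultimately show False using m by simp
qed (auto simp: W0_comp_def)

text \<open>The remaining variables \<open>Teps\<close> and \<open>T j\<close> have nonpositive
  degree in coordinate \<open>k + 1\<close>, where \<theta> is positive.\<close>

lemma Wu_not_generically_stable: "\<not> generically_stable n k \<theta> (Wu_comp n k)"
proof (rule not_generically_stableI[where V = "{Z1, Z2, Z3, Z4}"])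
  fix m :: nat and a :: "cox_var \<Rightarrow> nat"
  assume m: "m \<ge> 1" and a: "\<forall>v\<in>{Z1, Z2, Z3, Z4}. a v = 0"
    and eq: "total_deg k (\<lambda>v. int (a v)) = (\<lambda>j. int m * \<theta> j)"
  have "int m * \<theta> (k + 1) \<le> 0"
    using total_deg_eps[of k "\<lambda>v. int (a v)"] eq a by simp
  then show False using eps_pos m by (simp add: mult_le_0_iff)
qed (auto simp: Wu_comp_def)

end

theorem proposition3p20:
  fixes n k :: nat and \<zeta> :: complex
  assumes "n = 2 * k + 1" and "n \<ge> 3" and "primitive_root_of_unity n \<zeta>"
  shows "irreducible_components k (central_fibre n k \<zeta>) =
           W_comp n k ` {1..k} \<union> W'_comp n k ` {1..k} \<union> {W0_comp n k, Wu_comp n k}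
       \<and> (\<forall>i\<in>{1..k}. \<forall>\<theta>\<in>linearisations k i.
           stable_components n k \<zeta> \<theta> = W_comp n k ` {1..i} \<union> W'_comp n k ` {i..k})
       \<and> (\<forall>\<theta>\<in>linearisations k 0.
           stable_components n k \<zeta> \<theta> = {W0_comp n k} \<union> W'_comp n k ` {1..k})"
proof (intro conjI ballI)
  have "k \<ge> 1" "\<zeta> ^ n = 1"
    using assms by (auto simp: primitive_root_of_unity_def)
  from irreducible_components_central_fibre[OF assms(1) this]
  show comps: "irreducible_components k (central_fibre n k \<zeta>) =
           W_comp n k ` {1..k} \<union> W'_comp n k ` {1..k} \<union> {W0_comp n k, Wu_comp n k}" .
  fix i \<theta>
  assume i: "i \<in> {1..k}" and \<theta>: "\<theta> \<in> linearisations k i"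
  then interpret chamber_character k i \<theta> by unfold_locales auto
  \<comment> \<open>The criteria for and against stability are complementary in \<open>j\<close>; at
    \<open>j = i\<close> both families are stable.\<close>
  have "generically_stable n k \<theta> (W_comp n k j) \<longleftrightarrow> j \<le> i"
    "generically_stable n k \<theta> (W'_comp n k j) \<longleftrightarrow> i \<le> j" if "j \<in> {1..k}" for j
    using that W_generically_stable[OF assms(1)] W_not_generically_stable
      W'_generically_stable[OF assms(1)] W'_not_generically_stable by (meson not_le)+
  moreover have "\<not> generically_stable n k \<theta> (W0_comp n k)" "\<not> generically_stable n k \<theta> (Wu_comp n k)"
    using W0_not_generically_stable Wu_not_generically_stable i by auto
  ultimately show "stable_components n k \<zeta> \<theta> = W_comp n k ` {1..i} \<union> W'_comp n k ` {i..k}"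
    unfolding stable_components_def comps using i by auto
next
  have "k \<ge> 1" "\<zeta> ^ n = 1"
    using assms by (auto simp: primitive_root_of_unity_def)
  note comps = irreducible_components_central_fibre[OF assms(1) this]
  fix \<theta>
  assume \<theta>: "\<theta> \<in> linearisations k 0"
  then interpret chamber_character k 0 \<theta> by unfold_locales auto
  have "\<not> generically_stable n k \<theta> (W_comp n k j)" "generically_stable n k \<theta> (W'_comp n k j)"
    if "j \<in> {1..k}" for j
    using that W_not_generically_stable W'_generically_stable[OF assms(1)] by auto
  moreover have "generically_stable n k \<theta> (W0_comp n k)" "\<not> generically_stable n k \<theta> (Wu_comp n k)"
    using W0_generically_stable[OF assms(1)] Wu_not_generically_stable by auto
  ultimately show "stable_components n k \<zeta> \<theta> = {W0_comp n k} \<union> W'_comp n k ` {1..k}"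
    unfolding stable_components_def comps by auto
qed

end
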